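(* Let $\mathcal{D}_{\mathrm{Hom}}$, $\mathcal{D}'_{\mathrm{Hom}}$, $\mathcal{D}_{\mathfrak g(\Gamma)}$, $\mathcal{D}_{\mathbb F[t,t^{-1}]}$, $\mathcal{D}_{\mathbb F[t,t^{-1}]\frac{d}{dt}}$ be the spaces of derivations of $\mathscr W(\Gamma,s)$ defined in the context. Then the derivation space of $\mathscr W(\Gamma,s)$ has the decomposition $$\mathrm{Der}\,\mathscr W(\Gamma,s)=\mathrm{ad}\,\mathscr W(\Gamma,s)+\Big(\mathcal{D}_{\mathrm{Hom}}\oplus\mathcal{D}_{\mathfrak g(\Gamma)}\oplus\mathcal{D}_{\mathbb F[t,t^{-1}]}\oplus\mathcal{D}_{\mathbb F[t,t^{-1}]\frac{d}{dt}}\Big),$$ and the first cohomology group $H^1(\mathscr W(\Gamma,s),\mathscr W(\Gamma,s))\cong \mathrm{Der}\,\mathscr W(\Gamma,s)/\mathrm{ad}\,\mathscr W(\Gamma,s)$ is linearly isomorphic to $$\big(\mathcal{D}_{\mathrm{Hom}}/\mathcal{D}'_{\mathrm{Hom}}\big)\oplus\mathcal{D}_{\mathfrak g(\Gamma)}\oplus\mathcal{D}_{\mathbb F[t,t^{-1}]}\oplus\mathcal{D}_{\mathbb F[t,t^{-1}]\frac{d}{dt}}.$$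
   Context: Let $\mathbb F$ be a field of characteristic $0$, $\Gamma$ a proper additive subgroup of $\mathbb F$, and $s\in\mathbb F$ with $s\notin\Gamma$, $2s\in\Gamma$. Put $\Gamma_1=s+\Gamma$ and $T=\Gamma\cup\Gamma_1$ (an additive subgroup of $\mathbb F$). The generalized loop Schr\"odinger-Virasoro algebra $\mathscr W(\Gamma,s)$ is the Lie algebra over $\mathbb F$ with basis $\{L_{\alpha,i},M_{\alpha,i},Y_{\alpha+s,i}\mid\alpha\in\Gamma,\ i\in\mathbb Z\}$ and brackets $[L_{\alpha,i},L_{\beta,j}]=(\beta-\alpha)L_{\alpha+\beta,i+j}$, $[L_{\alpha,i},M_{\beta,j}]=\beta M_{\alpha+\beta,i+j}$, $[L_{\alpha,i},Y_{\beta+s,j}]=(\beta+s-\frac{\alpha}{2})Y_{\alpha+\beta+s,i+j}$, $[M_{\alpha,i},M_{\beta,j}]=0$, $[M_{\alpha,i},Y_{\beta+s,j}]=0$, $[Y_{\alpha+s,i},Y_{\beta+s,j}]=(\beta-\alpha)M_{\alpha+\beta+2s,i+j}$ for $\alpha,\beta\in\Gamma$, $i,j\in\mathbb Z$. Write $X_{\gamma,i}=X_\gamma\otimes t^i=X_\gamma t^i$ for $X\in\{L,M,Y\}$, and for $f\in\mathbb F[t,t^{-1}]$ let $fX_{\gamma,i}=X_\gamma\otimes ft^i$. Undefined symbols are zero: $L_{\alpha+s,i}=M_{\alpha+s,i}=Y_{\alpha,i}=0$ for $\alpha\in\Gamma$. $\mathrm{Der}\,\mathscr W(\Gamma,s)$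 is the space of all $\mathbb F$-linear derivations and $\mathrm{ad}\,\mathscr W(\Gamma,s)$ the space of inner derivations $\mathrm{ad}_z(x)=[z,x]$. $\mathrm{Hom}_{\mathbb Z}(T,\mathbb F[t,t^{-1}])$ is the space of group homomorphisms $T\to\mathbb F[t,t^{-1}]$; $\mathbb F[t,t^{-1}]\frac{d}{dt}$ is the derivation algebra of $\mathbb F[t,t^{-1}]$; and $\mathfrak g(\Gamma)=\{g:\Gamma\to\mathbb F[t,t^{-1}]\mid(\beta-\alpha)g_{\alpha+\beta}=\beta g_\beta-\alpha g_\alpha\ \ \forall\alpha,\beta\in\Gamma\}$, where $g_\alpha$ denotes the value of $g$ at $\alpha$. For $\phi\in\mathrm{Hom}_{\mathbb Z}(T,\mathbb F[t,t^{-1}])$, $g\in\mathfrak g(\Gamma)$, $b\in\mathbb F[t,t^{-1}]$, $\rho\in\mathbb F[t,t^{-1}]\frac{d}{dt}$ define derivations of $\mathscr W(\Gamma,s)$ by (for all $X\in\{L,M,Y\}$, $\mu\in T$, $\alpha\in\Gamma$, $i\in\mathbb Z$): $D_\phi(X_{\mu,i})=\phi(\mu)X_{\mu,i}$; $D_g(L_{\alpha,i})=g_\alpha M_{\alpha,i}$, $D_g(M_{\alpha,i})=D_g(Y_{\alpha+s,i})=0$; $D_b(L_{\alpha,i})=0$, $D_b(M_{\alpha,i})=bM_{\alpha,i}$, $D_b(Y_{\alpha+s,i})=\frac12 bY_{\alpha+s,i}$; $D^\rho(X_{\mu,i})=X_\mu\rho(t^i)$. Set $\mathcal{D}_{\mathrm{Hom}}=\{D_\phi\mid\phi\in\mathrm{Hom}_{\mathbb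 Z}(T,\mathbb F[t,t^{-1}])\}$; $\mathcal{D}'_{\mathrm{Hom}}=\{D_\phi\mid\exists f(t)\in\mathbb F[t,t^{-1}]\text{ such that }\phi(\gamma)=\gamma f(t)\ \forall\gamma\in T\}$; $\mathcal{D}_{\mathfrak g(\Gamma)}=\mathrm{span}\{D_g\mid g\in\mathfrak g(\Gamma)\}$; $\mathcal{D}_{\mathbb F[t,t^{-1}]}=\{D_b\mid b\in\mathbb F[t,t^{-1}]\}$; $\mathcal{D}_{\mathbb F[t,t^{-1}]\frac{d}{dt}}=\{D^\rho\mid\rho\in\mathbb F[t,t^{-1}]\frac{d}{dt}\}$. *)

theory Defs
  imports
    Complex_Main
    "HOL-Library.Poly_Mapping"
    "HOL-Library.Function_Algebras"
    "HOL-Library.Set_Algebras"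
    "HOL-Library.Product_Plus"
begin

section \<open>Free vector spaces\<close>

text \<open>
  The free vector space on a type of indices is the type of finitely supported functions;
  \<open>single p 1\<close> is the basis vector with index \<open>p\<close>.
\<close>

definition vscale :: "'k::field \<Rightarrow> ('i \<Rightarrow>\<^sub>0 'k) \<Rightarrow> ('i \<Rightarrow>\<^sub>0 'k)" where
  "vscale c x = Poly_Mapping.map ((*) c) x"

text \<open>The linear map that sends the basis vector with index \<open>p\<close> to \<open>v p\<close>.\<close>

definition lin_ext :: "('i \<Rightarrow> 'j \<Rightarrow>\<^sub>0 'k) \<Rightarrow> ('i \<Rightarrow>\<^sub>0 'k) \<Rightarrow> ('j \<Rightarrow>\<^sub>0 'k::field)" where
  "lin_ext v x = (\<Sum>p\<in>Poly_Mapping.keys x. vscale (Poly_Mapping.lookup x p) (v p))"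

lemma lookup_vscale [simp]: "Poly_Mapping.lookup (vscale c x) p = c * Poly_Mapping.lookup x p"
  unfolding vscale_def by transfer (simp add: when_def)

lemma vector_space_vscale: "vector_space (vscale :: 'k::field \<Rightarrow> ('i \<Rightarrow>\<^sub>0 'k) \<Rightarrow> _)"
  by standard (auto intro!: poly_mapping_eqI simp: lookup_add algebra_simps)

lemma vscale_zero_right [simp]: "vscale c 0 = 0"
  by (auto intro!: poly_mapping_eqI)

lemma vscale_single [simp]: "vscale c (Poly_Mapping.single p a) = Poly_Mapping.single p (c * a)"
  by (auto intro!: poly_mapping_eqI simp: lookup_single when_def)

lemma lin_ext_superset:
  fixes v :: "'i \<Rightarrow> 'j \<Rightarrow>\<^sub>0 'k::field"
  assumes "finite S" "Poly_Mapping.keys x \<subseteq> S"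
  shows "lin_ext v x = (\<Sum>p\<in>S. vscale (Poly_Mapping.lookup x p) (v p))"
proof -
  interpret vector_space "vscale :: 'k \<Rightarrow> ('j \<Rightarrow>\<^sub>0 'k) \<Rightarrow> _" by (rule vector_space_vscale)
  show ?thesis
    unfolding lin_ext_def
    by (rule sum.mono_neutral_left) (use assms in \<open>auto simp: in_keys_iff\<close>)
qed

lemma lin_ext_add:
  fixes v :: "'i \<Rightarrow> 'j \<Rightarrow>\<^sub>0 'k::field"
  shows "lin_ext v (x + y) = lin_ext v x + lin_ext v y"
proof -
  interpret vector_space "vscale :: 'k \<Rightarrow> ('j \<Rightarrow>\<^sub>0 'k) \<Rightarrow> _" by (rule vector_space_vscale)
  let ?S = "Poly_Mapping.keys x \<union> Poly_Mapping.keys y"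
  have "lin_ext v z = (\<Sum>p\<in>?S. vscale (Poly_Mapping.lookup z p) (v p))"
    if "z \<in> {x, y, x + y}" for z
    by (rule lin_ext_superset) (use that keys_add[of x y] in auto)
  then show ?thesis
    by (simp add: lookup_add scale_left_distrib sum.distrib)
qed

lemma lin_ext_vscale:
  fixes v :: "'i \<Rightarrow> 'j \<Rightarrow>\<^sub>0 'k::field"
  shows "lin_ext v (vscale c x) = vscale c (lin_ext v x)"
proof -
  interpret vector_space "vscale :: 'k \<Rightarrow> ('j \<Rightarrow>\<^sub>0 'k) \<Rightarrow> _" by (rule vector_space_vscale)
  have "lin_ext v (vscale c x)
      = (\<Sum>p\<in>Poly_Mapping.keys x. vscale (Poly_Mapping.lookup (vscale c x) p) (v p))"
    by (rule lin_ext_superset) (auto simp: in_keys_iff)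
  then show ?thesis
    by (simp add: lin_ext_def scale_sum_right)
qed

lemma lin_ext_single [simp]:
  fixes v :: "'i \<Rightarrow> 'j \<Rightarrow>\<^sub>0 'k::field"
  shows "lin_ext v (Poly_Mapping.single p a) = vscale a (v p)"
proof -
  interpret vector_space "vscale :: 'k \<Rightarrow> ('j \<Rightarrow>\<^sub>0 'k) \<Rightarrow> _" by (rule vector_space_vscale)
  show ?thesis by (simp add: lin_ext_def)
qed

lemma lin_ext_add_fun:
  fixes v :: "'i \<Rightarrow> 'j \<Rightarrow>\<^sub>0 'k::field"
  shows "lin_ext (\<lambda>p. v p + w p) x = lin_ext v x + lin_ext w x"
proof -
  interpret vector_space "vscale :: 'k \<Rightarrow> ('j \<Rightarrow>\<^sub>0 'k) \<Rightarrow> _" by (rule vector_space_vscale)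
  show ?thesis by (simp add: lin_ext_def scale_right_distrib sum.distrib)
qed

section \<open>Laurent polynomials\<close>

text \<open>
  $F[t,t^{-1}]$ is the group ring of the integers: the product of \<^typ>\<open>int \<Rightarrow>\<^sub>0 'k\<close> provided
  by the library is convolution.
\<close>

type_synonym 'k laurent = "int \<Rightarrow>\<^sub>0 'k"

definition tpow :: "int \<Rightarrow> 'k::field laurent" where
  "tpow i = Poly_Mapping.single i 1"

definition ddt :: "'k::field laurent \<Rightarrow> 'k laurent" where
  "ddt = lin_ext (\<lambda>k. vscale (of_int k) (tpow (k - 1)))"

definition laurent_ders :: "('k::field laurent \<Rightarrow> 'k laurent) set" where
  "laurent_ders = {\<lambda>f. h * ddt f | h. True}"

lemma poly_mapping_additive_induct:
  assumes "\<And>p a. P (Poly_Mapping.single p a)" "\<And>x y. P x \<Longrightarrow> P y \<Longrightarrow> P (x + y)"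
  shows "P (x :: 'i \<Rightarrow>\<^sub>0 'k::field)"
proof (induction x rule: update_induct)
  case const
  show ?case using assms(1)[of undefined 0] by simp
next
  case (update f a b)
  have "Poly_Mapping.update a b f = f + Poly_Mapping.single a b"
    using update.hyps by (auto intro!: poly_mapping_eqI simp: lookup_update lookup_add lookup_single in_keys_iff when_def)
  then show ?case using assms update by simp
qed

text \<open>
  \<^const>\<open>laurent_ders\<close> is the derivation algebra of the Laurent polynomials.
\<close>

lemma laurent_ders_iff:
  fixes \<rho> :: "'k::field laurent \<Rightarrow> 'k laurent"
  shows "\<rho> \<in> laurent_ders \<longleftrightarrow>
    (\<forall>f g. \<rho> (f + g) = \<rho> f + \<rho> g) \<and> (\<forall>c f. \<rho> (vscale c f) = vscale c (\<rho> f)) \<and>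
    (\<forall>f g. \<rho> (f * g) = \<rho> f * g + f * \<rho> g)"
    (is "_ \<longleftrightarrow> ?add \<rho> \<and> ?scale \<rho> \<and> ?leib \<rho>")
proof -
  have mult_eq: "vscale c f = Poly_Mapping.single 0 c * f" for c and f :: "'k laurent"
    by (simp add: vscale_def mult_map_scale_conv_mult)
  have single_eq: "Poly_Mapping.single i a = vscale a (tpow i)" for i and a :: 'k
    by (simp add: tpow_def)
  have ddt_single: "ddt (Poly_Mapping.single i a) = Poly_Mapping.single (i - 1) (a * of_int i)"
    for i and a :: 'k
    by (simp add: ddt_def tpow_def)
  have ddt_add: "ddt (f + g) = ddt f + ddt g" for f g :: "'k laurent"
    by (simp add: ddt_def lin_ext_add)
  have ddt_vscale: "ddt (vscale c f) = vscale c (ddt f)" for c and f :: "'k laurent"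
    by (simp add: ddt_def lin_ext_vscale)
  have ddt_leib: "ddt (f * g) = ddt f * g + f * ddt g" for f g :: "'k laurent"
  proof (induction f rule: poly_mapping_additive_induct)
    case (1 i a)
    show ?case
    proof (induction g rule: poly_mapping_additive_induct)
      case (1 j b)
      show ?case
        by (simp add: ddt_single mult_single single_add[symmetric] algebra_simps)
    qed (simp add: ddt_add algebra_simps)
  qed (simp add: ddt_add algebra_simps)
  show ?thesis
  proof
    assume "\<rho> \<in> laurent_ders"
    then obtain h where "\<rho> = (\<lambda>f. h * ddt f)" by (auto simp: laurent_ders_def)
    then show "?add \<rho> \<and> ?scale \<rho> \<and> ?leib \<rho>"
      by (simp add: ddt_add ddt_leib ddt_vscale) (simp add: mult_eq algebra_simps)
  next
    assume *: "?add \<rho> \<and> ?scale \<rho> \<and> ?leib \<rho>"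
    define h where "h = \<rho> (tpow 1)"
    have one: "\<rho> 1 = 0"
      using * by (metis add_cancel_left_right mult.right_neutral mult.left_neutral)
    have mult: "tpow (i + j) = tpow i * (tpow j :: 'k laurent)" for i j
      by (simp add: tpow_def mult_single)
    have t0: "tpow 0 = (1 :: 'k laurent)" by (simp add: tpow_def)
    define e where "e i = tpow (- i) * \<rho> (tpow i)" for i :: int
    have inv: "tpow (- i) * tpow i = (1 :: 'k laurent)" for i
      by (simp add: mult[symmetric] t0)
    have e_add: "e (i + j) = e i + e j" for i j
    proof -
      have "e (i + j) = tpow (- i) * tpow (- j) * (\<rho> (tpow i) * tpow j + tpow i * \<rho> (tpow j))"
      proof -
        have "tpow (- (i + j)) = tpow (- i) * (tpow (- j) :: 'k laurent)"
          using mult[of "- i" "- j"] by simp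
        moreover have "\<rho> (tpow (i + j)) = \<rho> (tpow i) * tpow j + tpow i * \<rho> (tpow j)"
          using * by (simp only: mult)
        ultimately show ?thesis by (simp add: e_def)
      qed
      also have "\<dots> = (tpow (- j) * tpow j) * e i + (tpow (- i) * tpow i) * e j"
        by (simp add: e_def algebra_simps)
      finally show ?thesis by (simp add: inv)
    qed
    have e0: "e 0 = 0" by (simp add: e_def t0 one)
    have e_nat: "e (int n) = of_nat n * e 1" for n
      by (induction n) (use e_add in \<open>auto simp: e0 algebra_simps\<close>)
    have e_int: "e i = of_int i * e 1" for i
    proof (cases i)
      case (nonneg n)
      then show ?thesis using e_nat by simp
    next
      case (neg n)
      then have "e i + e (int (Suc n)) = 0" using e_add[of i "int (Suc n)"] e0 by simp
      then have "e i = - (of_nat (Suc n) * e 1)"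
        using e_nat[of "Suc n"] by (simp only: eq_neg_iff_add_eq_0)
      moreover have "(of_int i :: 'k laurent) = - of_nat (Suc n)" using neg by simp
      ultimately show ?thesis by (simp only: mult_minus_left)
    qed
    have gen: "\<rho> (tpow i) = h * ddt (tpow i)" for i
    proof -
      have "\<rho> (tpow i) = (tpow (- i) * tpow i) * \<rho> (tpow i)" by (simp add: inv)
      also have "\<dots> = tpow i * e i" by (simp add: e_def algebra_simps)
      also have "\<dots> = tpow i * (of_int i * (tpow (- 1) * h))"
        by (subst e_int) (simp only: e_def h_def)
      also have "\<dots> = h * (of_int i * (tpow i * tpow (- 1)))"
        by (simp only: mult_ac)
      also have "tpow i * tpow (- 1) = (tpow (i - 1) :: 'k laurent)"
        by (simp add: mult[symmetric])
      also have "of_int i * tpow (i - 1) = (ddt (tpow i) :: 'k laurent)"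
      proof -
        have "of_int i = (Poly_Mapping.single 0 (of_int i) :: 'k laurent)" by simp
        then show ?thesis by (simp only: tpow_def ddt_single mult_single) simp
      qed
      finally show ?thesis .
    qed
    have "\<rho> f = h * ddt f" for f
    proof (induction f rule: poly_mapping_additive_induct)
      case (1 i a)
      have "\<rho> (vscale a (tpow i)) = vscale a (h * ddt (tpow i))" using * gen by simp
      also have "\<dots> = h * ddt (vscale a (tpow i))"
        by (simp only: ddt_vscale) (simp only: mult_eq mult_ac)
      finally show ?case by (simp only: single_eq)
    qed (use * in \<open>simp add: ddt_add algebra_simps\<close>)
    then show "\<rho> \<in> laurent_ders" by (auto simp: laurent_ders_def)
  qed
qed

section \<open>Subspaces, quotients, isomorphisms\<close>

text \<open>
  Vector spaces are subsets of an ambient additive group type with scalar multiplication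
  \<open>scl\<close>. The addition of cosets is the setwise sum, and the sum of subspaces is the setwise
  sum, both written + as in the theory \<open>Set_Algebras\<close>.
\<close>

definition quot_space :: "'v::ab_group_add set \<Rightarrow> 'v set \<Rightarrow> 'v set set" where
  "quot_space V U = (\<lambda>x. x +o U) ` V"

text \<open>Adding \<open>U\<close> matters only for the scalar 0, where the image of a coset is \<open>{0}\<close>.\<close>

definition quot_scale ::
  "('k \<Rightarrow> 'v \<Rightarrow> 'v) \<Rightarrow> 'v::ab_group_add set \<Rightarrow> 'k \<Rightarrow> 'v set \<Rightarrow> 'v set" where
  "quot_scale scl U c C = scl c ` C + U"

lemma quot_add_coset:
  assumes "module scl" "module.subspace scl U"
  shows "(x +o U) + (y +o U) = (x + y) +o U"
proof -
  interpret module scl by fact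
  have U: "subspace U" by fact
  show ?thesis
  proof (rule set_eqI, rule iffI)
    fix z assume "z \<in> (x +o U) + (y +o U)"
    then obtain u v where "u \<in> U" "v \<in> U" "z = (x + u) + (y + v)"
      by (auto simp: set_plus_def elt_set_plus_def)
    then show "z \<in> (x + y) +o U"
      using subspace_add[OF U] by (auto simp: elt_set_plus_def algebra_simps intro!: bexI[of _ "u + v"])
  next
    fix z assume "z \<in> (x + y) +o U"
    then obtain u where "u \<in> U" "z = (x + u) + (y + 0)"
      by (auto simp: elt_set_plus_def algebra_simps)
    then show "z \<in> (x +o U) + (y +o U)"
      using subspace_0[OF U] by (auto simp: set_plus_def elt_set_plus_def)
  qed
qed

lemma quot_scale_coset:
  assumes "module scl" "module.subspace scl U"
  shows "quot_scale scl U c (x +o U) = scl c x +o U"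
proof -
  interpret module scl by fact
  have U: "subspace U" by fact
  show ?thesis
  proof (rule set_eqI, rule iffI)
    fix z assume "z \<in> quot_scale scl U c (x +o U)"
    then obtain u v where "u \<in> U" "v \<in> U" "z = scl c (x + u) + v"
      by (auto simp: quot_scale_def set_plus_def elt_set_plus_def)
    then show "z \<in> scl c x +o U"
      using subspace_add[OF U] subspace_scale[OF U]
      by (auto simp: elt_set_plus_def algebra_simps intro!: bexI[of _ "scl c u + v"])
  next
    fix z assume "z \<in> scl c x +o U"
    then obtain u where "u \<in> U" "z = scl c (x + 0) + u"
      by (auto simp: elt_set_plus_def)
    then show "z \<in> quot_scale scl U c (x +o U)"
      using subspace_0[OF U] unfolding quot_scale_def set_plus_def elt_set_plus_def by blast
  qed
qed

definition lin_isomorphic ::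
  "'v::plus set \<Rightarrow> ('k \<Rightarrow> 'v \<Rightarrow> 'v) \<Rightarrow> 'w::plus set \<Rightarrow> ('k \<Rightarrow> 'w \<Rightarrow> 'w) \<Rightarrow> bool" where
  "lin_isomorphic A sclA B sclB \<longleftrightarrow>
     (\<exists>f. bij_betw f A B \<and>
          (\<forall>x\<in>A. \<forall>y\<in>A. f (x + y) = f x + f y) \<and>
          (\<forall>c. \<forall>x\<in>A. f (sclA c x) = sclB c (f x)))"

text \<open>The subspaces \<open>A\<close>, \<open>B\<close>, \<open>C\<close>, \<open>D\<close> have a direct sum.\<close>

definition direct_sum4 ::
  "('k::field \<Rightarrow> 'v \<Rightarrow> 'v) \<Rightarrow> 'v::ab_group_add set \<Rightarrow> 'v set \<Rightarrow> 'v set \<Rightarrow> 'v set \<Rightarrow> bool" where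
  "direct_sum4 scl A B C D \<longleftrightarrow>
     module.subspace scl A \<and> module.subspace scl B \<and>
     module.subspace scl C \<and> module.subspace scl D \<and>
     (\<forall>a\<in>A. \<forall>b\<in>B. \<forall>c\<in>C. \<forall>d\<in>D. a + b + c + d = 0 \<longrightarrow> a = 0 \<and> b = 0 \<and> c = 0 \<and> d = 0)"

section \<open>Derivations and first cohomology\<close>

text \<open>
  In this section \<open>W\<close> is a subspace of an ambient space and \<open>br\<close> is a bracket on \<open>W\<close>. Linear
  maps on \<open>W\<close> are represented by functions that vanish outside of \<open>W\<close>, so that equality of
  functions is equality on \<open>W\<close> and the pointwise operations on functions are those of the
  space of linear maps.
\<close>

definition on_space :: "'v set \<Rightarrow> ('v \<Rightarrow> 'w::zero) \<Rightarrow> 'v \<Rightarrow> 'w" where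
  "on_space W f = (\<lambda>x. if x \<in> W then f x else 0)"

definition fscale :: "('k \<Rightarrow> 'v \<Rightarrow> 'v) \<Rightarrow> 'k \<Rightarrow> ('u \<Rightarrow> 'v) \<Rightarrow> 'u \<Rightarrow> 'v" where
  "fscale scl c f = (\<lambda>x. scl c (f x))"

lemma vector_space_fscale: "vector_space scl \<Longrightarrow> vector_space (fscale scl)"
  by (auto simp: vector_space_def fscale_def fun_eq_iff)

definition endos :: "('k \<Rightarrow> 'v \<Rightarrow> 'v) \<Rightarrow> 'v::ab_group_add set \<Rightarrow> ('v \<Rightarrow> 'v) set" where
  "endos scl W = {f. f ` W \<subseteq> W \<and> (\<forall>x. x \<notin> W \<longrightarrow> f x = 0) \<and>
     (\<forall>x\<in>W. \<forall>y\<in>W. f (x + y) = f x + f y) \<and> (\<forall>c. \<forall>x\<in>W. f (scl c x) = scl c (f x))}"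

definition derivations ::
  "('k \<Rightarrow> 'v \<Rightarrow> 'v) \<Rightarrow> ('v \<Rightarrow> 'v \<Rightarrow> 'v) \<Rightarrow> 'v::ab_group_add set \<Rightarrow> ('v \<Rightarrow> 'v) set" where
  "derivations scl br W =
     {D \<in> endos scl W. \<forall>x\<in>W. \<forall>y\<in>W. D (br x y) = br (D x) y + br x (D y)}"

definition inner_derivations ::
  "('v \<Rightarrow> 'v \<Rightarrow> 'v) \<Rightarrow> 'v::ab_group_add set \<Rightarrow> ('v \<Rightarrow> 'v) set" where
  "inner_derivations br W = {on_space W (\<lambda>x. br z x) | z. z \<in> W}"

text \<open>
  The Chevalley-Eilenberg differentials in degrees 0 and 1, with coefficients in the adjoint
  module.
\<close>

definition ce_d0 ::
  "('v \<Rightarrow> 'v \<Rightarrow> 'v) \<Rightarrow> 'v::ab_group_add set \<Rightarrow> 'v \<Rightarrow> ('v \<Rightarrow> 'v)" where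
  "ce_d0 br W v = on_space W (\<lambda>x. br x v)"

definition ce_d1 ::
  "('v \<Rightarrow> 'v \<Rightarrow> 'v) \<Rightarrow> ('v \<Rightarrow> 'v::ab_group_add) \<Rightarrow> ('v \<Rightarrow> 'v \<Rightarrow> 'v)" where
  "ce_d1 br f = (\<lambda>x y. br x (f y) - br y (f x) - f (br x y))"

definition cocycles1 ::
  "('k \<Rightarrow> 'v \<Rightarrow> 'v) \<Rightarrow> ('v \<Rightarrow> 'v \<Rightarrow> 'v) \<Rightarrow> 'v::ab_group_add set \<Rightarrow> ('v \<Rightarrow> 'v) set" where
  "cocycles1 scl br W = {f \<in> endos scl W. \<forall>x\<in>W. \<forall>y\<in>W. ce_d1 br f x y = 0}"

definition coboundaries1 ::
  "('v \<Rightarrow> 'v \<Rightarrow> 'v) \<Rightarrow> 'v::ab_group_add set \<Rightarrow> ('v \<Rightarrow> 'v) set" where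
  "coboundaries1 br W = ce_d0 br W ` W"

definition cohomology1 ::
  "('k \<Rightarrow> 'v \<Rightarrow> 'v) \<Rightarrow> ('v \<Rightarrow> 'v \<Rightarrow> 'v) \<Rightarrow> 'v::ab_group_add set \<Rightarrow> ('v \<Rightarrow> 'v) set set" where
  "cohomology1 scl br W = quot_space (cocycles1 scl br W) (coboundaries1 br W)"

section \<open>The generalized loop Schroedinger-Virasoro algebra\<close>

definition is_add_subgroup :: "'k::ab_group_add set \<Rightarrow> bool" where
  "is_add_subgroup G \<longleftrightarrow> 0 \<in> G \<and> (\<forall>x\<in>G. \<forall>y\<in>G. x + y \<in> G) \<and> (\<forall>x\<in>G. - x \<in> G)"

datatype sv_kind = SVL | SVM | SVY

text \<open>
  An index \<open>(X, \<mu>, i)\<close> stands for $X_{\mu,i}$. The basis vectors $Y_{\alpha+s,i}$ are indexed by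
  \<open>\<mu> = \<alpha> + s\<close>.
\<close>

type_synonym 'k sv_index = "sv_kind \<times> 'k \<times> int"

type_synonym 'k sv = "'k sv_index \<Rightarrow>\<^sub>0 'k"

definition shifted :: "'k::field set \<Rightarrow> 'k \<Rightarrow> 'k set" where
  "shifted G s = (\<lambda>\<alpha>. \<alpha> + s) ` G"

definition weights :: "'k::field set \<Rightarrow> 'k \<Rightarrow> 'k set" where
  "weights G s = G \<union> shifted G s"

definition sv_basis :: "'k::field set \<Rightarrow> 'k \<Rightarrow> 'k sv_index set" where
  "sv_basis G s =
     {(SVL, \<alpha>, i) | \<alpha> i. \<alpha> \<in> G} \<union> {(SVM, \<alpha>, i) | \<alpha> i. \<alpha> \<in> G} \<union>
     {(SVY, \<mu>, i) | \<mu> i. \<mu> \<in> shifted G s}"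

definition sv_space :: "'k::field set \<Rightarrow> 'k \<Rightarrow> 'k sv set" where
  "sv_space G s = {x. Poly_Mapping.keys x \<subseteq> sv_basis G s}"

text \<open>The vector $X_{\mu,i}$, with the convention that undefined symbols are zero.\<close>

definition sv_vec :: "'k::field set \<Rightarrow> 'k \<Rightarrow> sv_kind \<Rightarrow> 'k \<Rightarrow> int \<Rightarrow> 'k sv" where
  "sv_vec G s X \<mu> i =
     (if (X, \<mu>, i) \<in> sv_basis G s then Poly_Mapping.single (X, \<mu>, i) 1 else 0)"

text \<open>The vector $X_\mu \otimes f$.\<close>

definition sv_tensor :: "'k::field set \<Rightarrow> 'k \<Rightarrow> sv_kind \<Rightarrow> 'k \<Rightarrow> 'k laurent \<Rightarrow> 'k sv" where
  "sv_tensor G s X \<mu> f = lin_ext (\<lambda>k. sv_vec G s X \<mu> k) f"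

text \<open>
  Brackets of basis vectors. In terms of the index \<open>\<nu> = \<beta> + s\<close> of $Y_{\beta+s,j}$ the coefficient
  $\beta+s-\alpha/2$ reads \<open>\<nu> - \<alpha> / 2\<close>, and for \<open>\<mu> = \<alpha> + s\<close> one has \<open>\<nu> - \<mu> = \<beta> - \<alpha>\<close> and
  \<open>\<mu> + \<nu> = \<alpha> + \<beta> + 2 * s\<close>. The formulas make sense for all indices, not only those in
  \<^const>\<open>sv_basis\<close>; the bracket is only used on \<^const>\<open>sv_space\<close>.
\<close>

fun sv_br :: "'k::field sv_index \<Rightarrow> 'k sv_index \<Rightarrow> 'k sv" where
  "sv_br (SVL, \<alpha>, i) (SVL, \<beta>, j) = Poly_Mapping.single (SVL, \<alpha> + \<beta>, i + j) (\<beta> - \<alpha>)"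
| "sv_br (SVL, \<alpha>, i) (SVM, \<beta>, j) = Poly_Mapping.single (SVM, \<alpha> + \<beta>, i + j) \<beta>"
| "sv_br (SVM, \<alpha>, i) (SVL, \<beta>, j) = Poly_Mapping.single (SVM, \<alpha> + \<beta>, i + j) (- \<alpha>)"
| "sv_br (SVL, \<alpha>, i) (SVY, \<nu>, j) = Poly_Mapping.single (SVY, \<alpha> + \<nu>, i + j) (\<nu> - \<alpha> / 2)"
| "sv_br (SVY, \<mu>, i) (SVL, \<beta>, j) = Poly_Mapping.single (SVY, \<mu> + \<beta>, i + j) (- (\<mu> - \<beta> / 2))"
| "sv_br (SVM, \<alpha>, i) (SVM, \<beta>, j) = 0"
| "sv_br (SVM, \<alpha>, i) (SVY, \<nu>, j) = 0"
| "sv_br (SVY, \<mu>, i) (SVM, \<beta>, j) = 0"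
| "sv_br (SVY, \<mu>, i) (SVY, \<nu>, j) = Poly_Mapping.single (SVM, \<mu> + \<nu>, i + j) (\<nu> - \<mu>)"

definition sv_bracket :: "'k::field sv \<Rightarrow> 'k sv \<Rightarrow> 'k sv" where
  "sv_bracket x y = lin_ext (\<lambda>p. lin_ext (\<lambda>q. sv_br p q) y) x"

lemma sv_bracket_closed:
  assumes G: "is_add_subgroup G" "2 * s \<in> G" and xy: "x \<in> sv_space G s" "y \<in> sv_space G s"
  shows "sv_bracket x y \<in> sv_space G s"
proof -
  have 0: "0 \<in> sv_space G s" by (simp add: sv_space_def)
  have add: "u + v \<in> sv_space G s" if "u \<in> sv_space G s" "v \<in> sv_space G s" for u v
    using that keys_add[of u v] by (auto simp: sv_space_def)
  have scale: "vscale c u \<in> sv_space G s" if "u \<in> sv_space G s" for c u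
    using that by (auto simp: sv_space_def subset_iff in_keys_iff)
  have ext: "lin_ext v u \<in> sv_space G s" if "\<And>p. p \<in> Poly_Mapping.keys u \<Longrightarrow> v p \<in> sv_space G s" for u v
  proof -
    have "(\<Sum>p\<in>S. vscale (Poly_Mapping.lookup u p) (v p)) \<in> sv_space G s"
      if "finite S" "S \<subseteq> Poly_Mapping.keys u" for S
      using that by (induction S) (use \<open>\<And>p. p \<in> Poly_Mapping.keys u \<Longrightarrow> v p \<in> sv_space G s\<close> in \<open>auto intro: 0 add scale\<close>)
    then show ?thesis by (simp add: lin_ext_def)
  qed
  have sg: "Poly_Mapping.single p a \<in> sv_space G s" if "p \<in> sv_basis G s" for p a
    using that by (auto simp: sv_space_def)
  have plus: "\<alpha> + \<beta> \<in> G" if "\<alpha> \<in> G" "\<beta> \<in> G" for \<alpha> \<beta>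
    using that G by (auto simp: is_add_subgroup_def)
  have YY: "(\<alpha> + s) + (\<beta> + s) \<in> G" if "\<alpha> \<in> G" "\<beta> \<in> G" for \<alpha> \<beta>
    using plus[OF plus[OF that] G(2)] by (simp add: algebra_simps)
  have LY: "\<alpha> + (\<beta> + s) \<in> shifted G s" "(\<beta> + s) + \<alpha> \<in> shifted G s"
    if "\<alpha> \<in> G" "\<beta> \<in> G" for \<alpha> \<beta>
    using plus[OF that] by (auto simp: shifted_def algebra_simps image_iff intro!: bexI[of _ "\<alpha> + \<beta>"])
  have "sv_br p q \<in> sv_space G s" if "p \<in> sv_basis G s" "q \<in> sv_basis G s" for p q
    using that plus YY LY unfolding sv_basis_def
    by (auto intro!: sg 0 simp: sv_basis_def) (auto simp: shifted_def)
  moreover have "p \<in> sv_basis G s" if "p \<in> Poly_Mapping.keys u" "u \<in> {x, y}" for p u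
    using that xy by (auto simp: sv_space_def)
  ultimately show ?thesis
    unfolding sv_bracket_def by (intro ext) blast
qed

lemma sv_bracket_single:
  "sv_bracket (Poly_Mapping.single p a) (Poly_Mapping.single q b) = vscale (a * b) (sv_br p q)"
  by (auto simp: sv_bracket_def intro!: poly_mapping_eqI)

lemma sv_bracket_add_left: "sv_bracket (x + x') y = sv_bracket x y + sv_bracket x' y"
  by (simp add: sv_bracket_def lin_ext_add)

lemma sv_bracket_add_right: "sv_bracket x (y + y') = sv_bracket x y + sv_bracket x y'"
  by (simp add: sv_bracket_def lin_ext_add lin_ext_add_fun)

lemma sv_bracket_antisym: "sv_bracket x y = - sv_bracket y x"
proof (induction x rule: poly_mapping_additive_induct)
  case (1 p a)
  show ?case
  proof (induction y rule: poly_mapping_additive_induct)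
    case (1 q b)
    have "sv_br p q = - sv_br q p"
      by (induction p q rule: sv_br.induct)
        (auto intro!: poly_mapping_eqI simp: lookup_single when_def add.commute)
    then show ?case
      by (auto intro!: poly_mapping_eqI simp: sv_bracket_single)
  qed (simp add: sv_bracket_add_left sv_bracket_add_right)
qed (simp add: sv_bracket_add_left sv_bracket_add_right)

lemma sv_bracket_vscale_left: "sv_bracket (vscale c x) y = vscale c (sv_bracket x y)"
  by (simp add: sv_bracket_def lin_ext_vscale)

lemma sv_bracket_vscale_right: "sv_bracket x (vscale c y) = vscale c (sv_bracket x y)"
  using sv_bracket_antisym[of x y] sv_bracket_antisym[of x "vscale c y"]
  by (auto intro!: poly_mapping_eqI simp: sv_bracket_vscale_left)

lemma sv_bracket_self: "sv_bracket x x = (0 :: 'k::field_char_0 sv)"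
proof (rule poly_mapping_eqI)
  fix p
  have "Poly_Mapping.lookup (sv_bracket x x) p = - Poly_Mapping.lookup (sv_bracket x x) p"
    using arg_cong[OF sv_bracket_antisym[of x x], of "\<lambda>z. Poly_Mapping.lookup z p"] by simp
  then have "2 * Poly_Mapping.lookup (sv_bracket x x) p = 0" by (metis add.right_inverse mult_2)
  then show "Poly_Mapping.lookup (sv_bracket x x) p = Poly_Mapping.lookup 0 p" by simp
qed

lemma sv_bracket_zero [simp]: "sv_bracket x 0 = 0" "sv_bracket 0 x = 0"
  using sv_bracket_add_right[of x 0 0] sv_bracket_add_left[of 0 0 x] by simp_all

lemma sv_bracket_jacobi:
  fixes x y z :: "'k::field_char_0 sv"
  shows "sv_bracket x (sv_bracket y z) + sv_bracket y (sv_bracket z x) +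
    sv_bracket z (sv_bracket x y) = 0"
proof -
  define J :: "'k sv \<Rightarrow> 'k sv \<Rightarrow> 'k sv \<Rightarrow> 'k sv" where
    "J x y z = sv_bracket x (sv_bracket y z) + sv_bracket y (sv_bracket z x) +
      sv_bracket z (sv_bracket x y)" for x y z
  have J1: "J (x + x') y z = J x y z + J x' y z" for x x' y z
    by (simp add: J_def sv_bracket_add_left sv_bracket_add_right)
  have J2: "J x (y + y') z = J x y z + J x y' z" for x y y' z
    by (simp add: J_def sv_bracket_add_left sv_bracket_add_right)
  have J3: "J x y (z + z') = J x y z + J x y z'" for x y z z'
    by (simp add: J_def sv_bracket_add_left sv_bracket_add_right)
  have J0: "J (Poly_Mapping.single (X, \<mu>, i) a) (Poly_Mapping.single (Y, \<nu>, j) b)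
      (Poly_Mapping.single (Z, \<kappa>, k) c) = 0" for X \<mu> i a Y \<nu> j b Z \<kappa> k c
  proof -
    have sum3: "Poly_Mapping.single p u + Poly_Mapping.single q v + Poly_Mapping.single r w = 0"
      if "q = p" "r = p" "u + v + w = 0" for p q r :: "'k sv_index" and u v w :: 'k
      using that by (simp add: single_add[symmetric])
    show ?thesis
      by (cases X; cases Y; cases Z; simp add: J_def sv_bracket_single; (rule sum3)?)
        (simp_all add: field_simps)
  qed
  have "J x y z = 0"
  proof (induction x rule: poly_mapping_additive_induct)
    case (1 p a)
    show ?case
    proof (induction y rule: poly_mapping_additive_induct)
      case (1 q b)
      show ?case
      proof (induction z rule: poly_mapping_additive_induct)
        case (1 r c)
        show ?case by (cases p; cases q; cases r) (simp add: J0)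
      qed (simp add: J3)
    qed (simp add: J2)
  qed (simp add: J1)
  then show ?thesis by (simp add: J_def)
qed

abbreviation sv_fscale :: "'k::field \<Rightarrow> ('k sv \<Rightarrow> 'k sv) \<Rightarrow> 'k sv \<Rightarrow> 'k sv" where
  "sv_fscale \<equiv> fscale vscale"

definition sv_Der :: "'k::field set \<Rightarrow> 'k \<Rightarrow> ('k sv \<Rightarrow> 'k sv) set" where
  "sv_Der G s = derivations vscale sv_bracket (sv_space G s)"

definition sv_ad :: "'k::field set \<Rightarrow> 'k \<Rightarrow> ('k sv \<Rightarrow> 'k sv) set" where
  "sv_ad G s = inner_derivations sv_bracket (sv_space G s)"

definition sv_H1 :: "'k::field set \<Rightarrow> 'k \<Rightarrow> ('k sv \<Rightarrow> 'k sv) set set" where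
  "sv_H1 G s = cohomology1 vscale sv_bracket (sv_space G s)"

section \<open>The outer derivations\<close>

text \<open>
  Homomorphisms on the weights and elements of \<open>g_space G\<close> are represented by functions on all of
  the field. Their values elsewhere are arbitrary and do not affect the derivations defined
  from them.
\<close>

definition hom_weights :: "'k::field set \<Rightarrow> 'k \<Rightarrow> ('k \<Rightarrow> 'k laurent) set" where
  "hom_weights G s =
     {\<phi>. \<forall>\<mu>\<in>weights G s. \<forall>\<nu>\<in>weights G s. \<phi> (\<mu> + \<nu>) = \<phi> \<mu> + \<phi> \<nu>}"

definition g_space :: "'k::field set \<Rightarrow> ('k \<Rightarrow> 'k laurent) set" where
  "g_space G =
     {g. \<forall>\<alpha>\<in>G. \<forall>\<beta>\<in>G. vscale (\<beta> - \<alpha>) (g (\<alpha> + \<beta>)) = vscale \<beta> (g \<beta>) - vscale \<alpha> (g \<alpha>)}"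

definition D_phi :: "'k::field set \<Rightarrow> 'k \<Rightarrow> ('k \<Rightarrow> 'k laurent) \<Rightarrow> 'k sv \<Rightarrow> 'k sv" where
  "D_phi G s \<phi> = on_space (sv_space G s)
     (lin_ext (\<lambda>(X, \<mu>, i). sv_tensor G s X \<mu> (\<phi> \<mu> * tpow i)))"

definition D_g :: "'k::field set \<Rightarrow> 'k \<Rightarrow> ('k \<Rightarrow> 'k laurent) \<Rightarrow> 'k sv \<Rightarrow> 'k sv" where
  "D_g G s g = on_space (sv_space G s)
     (lin_ext (\<lambda>(X, \<mu>, i). case X of
        SVL \<Rightarrow> sv_tensor G s SVM \<mu> (g \<mu> * tpow i) | SVM \<Rightarrow> 0 | SVY \<Rightarrow> 0))"

definition D_b :: "'k::field set \<Rightarrow> 'k \<Rightarrow> 'k laurent \<Rightarrow> 'k sv \<Rightarrow> 'k sv" where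
  "D_b G s b = on_space (sv_space G s)
     (lin_ext (\<lambda>(X, \<mu>, i). case X of
        SVL \<Rightarrow> 0
      | SVM \<Rightarrow> sv_tensor G s SVM \<mu> (b * tpow i)
      | SVY \<Rightarrow> vscale (1 / 2) (sv_tensor G s SVY \<mu> (b * tpow i))))"

definition D_rho ::
  "'k::field set \<Rightarrow> 'k \<Rightarrow> ('k laurent \<Rightarrow> 'k laurent) \<Rightarrow> 'k sv \<Rightarrow> 'k sv" where
  "D_rho G s \<rho> = on_space (sv_space G s)
     (lin_ext (\<lambda>(X, \<mu>, i). sv_tensor G s X \<mu> (\<rho> (tpow i))))"

definition DD_Hom :: "'k::field set \<Rightarrow> 'k \<Rightarrow> ('k sv \<Rightarrow> 'k sv) set" where
  "DD_Hom G s = {D_phi G s \<phi> | \<phi>. \<phi> \<in> hom_weights G s}"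

definition DD_Hom' :: "'k::field set \<Rightarrow> 'k \<Rightarrow> ('k sv \<Rightarrow> 'k sv) set" where
  "DD_Hom' G s = {D_phi G s \<phi> | \<phi>. \<phi> \<in> hom_weights G s \<and>
     (\<exists>f. \<forall>\<gamma>\<in>weights G s. \<phi> \<gamma> = vscale \<gamma> f)}"

definition DD_g :: "'k::field set \<Rightarrow> 'k \<Rightarrow> ('k sv \<Rightarrow> 'k sv) set" where
  "DD_g G s = module.span sv_fscale {D_g G s g | g. g \<in> g_space G}"

definition DD_b :: "'k::field set \<Rightarrow> 'k \<Rightarrow> ('k sv \<Rightarrow> 'k sv) set" where
  "DD_b G s = {D_b G s b | b. True}"

definition DD_rho :: "'k::field set \<Rightarrow> 'k \<Rightarrow> ('k sv \<Rightarrow> 'k sv) set" where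
  "DD_rho G s = {D_rho G s \<rho> | \<rho>. \<rho> \<in> laurent_ders}"

text \<open>
  The external direct sum of \<open>DD_Hom / DD_Hom'\<close>, \<open>DD_g\<close>, \<open>DD_b\<close> and \<open>DD_rho\<close>: quadruples,
  with componentwise addition from the theory \<open>Product_Plus\<close>.
\<close>

definition outer_sum ::
  "'k::field set \<Rightarrow> 'k \<Rightarrow>
   (('k sv \<Rightarrow> 'k sv) set \<times> ('k sv \<Rightarrow> 'k sv) \<times> ('k sv \<Rightarrow> 'k sv) \<times> ('k sv \<Rightarrow> 'k sv)) set" where
  "outer_sum G s =
     quot_space (DD_Hom G s) (DD_Hom' G s) \<times> DD_g G s \<times> DD_b G s \<times> DD_rho G s"

definition outer_scale ::
  "'k::field set \<Rightarrow> 'k \<Rightarrow> 'k \<Rightarrow>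
   ('k sv \<Rightarrow> 'k sv) set \<times> ('k sv \<Rightarrow> 'k sv) \<times> ('k sv \<Rightarrow> 'k sv) \<times> ('k sv \<Rightarrow> 'k sv) \<Rightarrow>
   ('k sv \<Rightarrow> 'k sv) set \<times> ('k sv \<Rightarrow> 'k sv) \<times> ('k sv \<Rightarrow> 'k sv) \<times> ('k sv \<Rightarrow> 'k sv)" where
  "outer_scale G s c = (\<lambda>(C, d1, d2, d3).
     (quot_scale sv_fscale (DD_Hom' G s) c C, sv_fscale c d1, sv_fscale c d2, sv_fscale c d3))"

end

theory Submission
  imports Defs
begin

text \<open>
  $L_{0,0}$ acts on the vectors of weight $\mu$ by the scalar $\mu$. Hence every derivation can be
  corrected by an inner one so that it maps $L_{0,0}$ into weight 0, and a derivation with this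
  property preserves all weight spaces. It is then given by $F$-linear operators on the Laurent
  polynomials, one for each weight and each pair of kinds, and the Leibniz rule turns into
  functional equations for them: the operator on $L_\alpha$ is $f \mapsto \rho(f) + \phi(\alpha) f$ with
  a derivation $\rho$ and an additive $\phi$, the one on $M_\alpha$ differs from it by a multiplication
  $b$ independent of $\alpha$, the one on $Y_\mu$ by $b / 2$, and the component from $L_\alpha$ to
  $M_\alpha$ is multiplication by $g_\alpha$. An inner derivation that preserves weights comes from
  $L_0 \otimes f$, as $M_0 \otimes h$ is central; it is $D_\phi$ with $\phi(\mu) = \mu f$.
\<close>

text \<open>The obstacle is that the structure constants vanish on some pairs of weights: \<alpha> =
  \<beta> for [L, L], \<beta> = 0 for [L_\<alpha>, M_\<beta>], \<nu> = \<alpha> / 2 for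
  [L_\<alpha>, Y_\<nu>] and \<mu> = \<nu> for [Y, Y]. There the Leibniz rule says nothing about the
  operator at the sum of the two weights, so each functional equation is known at first only off an
  exceptional set and is extended by a detour through other weights. The detours need a nonzero
  weight in \<open>G\<close>, such as 2s, and characteristic 0. The factor 1/2 of b on Y comes from
  [Y, Y] landing in M: two Y-factors together account for one b. No component from M to L survives,
  because M commutes with Y whereas L_\<alpha> moves some Y_\<nu>. Since ad and the outer part share
  \<open>DD_Hom'\<close>, the isomorphism is deduced from a general statement on four independent
  subspaces and a fifth that meets their sum inside the first.\<close>

interpretation vs: vector_space vscale
  by (rule vector_space_vscale)

lemma vscale_conv_mult: "vscale c f = Poly_Mapping.single 0 c * (f :: 'k::field laurent)"
  by (simp add: vscale_def mult_map_scale_conv_mult)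

lemma vscale_mult_left: "vscale c f * g = vscale c (f * g :: 'k::field laurent)"
  by (simp add: vscale_conv_mult mult.assoc)

lemma vscale_mult_right: "f * vscale c g = vscale c (f * g :: 'k::field laurent)"
  by (simp add: vscale_conv_mult mult.left_commute)

lemma lin_ext_vscale_fun:
  fixes v :: "'i \<Rightarrow> 'j \<Rightarrow>\<^sub>0 'k::field"
  shows "lin_ext (\<lambda>p. vscale c (v p)) x = vscale c (lin_ext v x)"
  by (simp add: lin_ext_def vs.scale_sum_right mult.commute)

text \<open>Serves to recognise a \<open>lin_ext\<close> over monomials as a known operator, such as
  multiplication by a fixed Laurent polynomial; for the identity it writes an element as the sum of
  its terms.\<close>

lemma lin_ext_linear:
  fixes \<psi> :: "('i \<Rightarrow>\<^sub>0 'k::field) \<Rightarrow> ('j \<Rightarrow>\<^sub>0 'k)"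
  assumes add: "\<And>f g. \<psi> (f + g) = \<psi> f + \<psi> g" and scale: "\<And>c f. \<psi> (vscale c f) = vscale c (\<psi> f)"
  shows "lin_ext (\<lambda>k. \<psi> (Poly_Mapping.single k 1)) f = \<psi> f"
proof (induction f rule: poly_mapping_additive_induct)
  case (1 p a)
  then show ?case using scale[of a "Poly_Mapping.single p 1"] by simp
qed (simp add: lin_ext_add add)

section \<open>Quotients by subspaces\<close>

lemma coset_eq_iff:
  assumes "module scl" "module.subspace scl U"
  shows "x +o U = y +o U \<longleftrightarrow> x - y \<in> (U :: 'v::ab_group_add set)"
proof -
  interpret module scl by fact
  have U: "subspace U" by fact
  show ?thesis
  proof
    assume "x +o U = y +o U"
    moreover have "x \<in> x +o U" using subspace_0[OF U] by (auto simp: elt_set_plus_def)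
    ultimately show "x - y \<in> U" by (auto simp: elt_set_plus_def)
  next
    assume d: "x - y \<in> U"
    have "x + u = y + ((x - y) + u)" "y + u = x + (u - (x - y))" for u by simp_all
    moreover have "(x - y) + u \<in> U" "u - (x - y) \<in> U" if "u \<in> U" for u
      using that d subspace_add[OF U] subspace_diff[OF U] by blast+
    ultimately show "x +o U = y +o U"
      unfolding elt_set_plus_def by blast
  qed
qed

text \<open>Closure of \<open>A\<close> is not part of \<open>lin_isomorphic\<close>; it is what
  allows the inverse to be compared on a sum or a multiple of preimages.\<close>

lemma lin_isomorphic_sym:
  fixes sclA :: "'k \<Rightarrow> 'v::plus \<Rightarrow> 'v" and sclB :: "'k \<Rightarrow> 'w::plus \<Rightarrow> 'w"
  assumes "lin_isomorphic A sclA B sclB"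
    and "\<And>x y. x \<in> A \<Longrightarrow> y \<in> A \<Longrightarrow> x + y \<in> A" and "\<And>c x. x \<in> A \<Longrightarrow> sclA c x \<in> A"
  shows "lin_isomorphic B sclB A sclA"
proof -
  obtain f where f: "bij_betw f A B" "\<And>x y. x \<in> A \<Longrightarrow> y \<in> A \<Longrightarrow> f (x + y) = f x + f y"
    "\<And>c x. x \<in> A \<Longrightarrow> f (sclA c x) = sclB c (f x)"
    using assms(1) unfolding lin_isomorphic_def by blast
  define g where "g = inv_into A f"
  have g: "g y \<in> A" "f (g y) = y" if "y \<in> B" for y
    using that f(1) by (auto simp: g_def bij_betw_def f_inv_into_f inv_into_into)
  have gf: "g (f x) = x" if "x \<in> A" for x
    using that f(1) by (auto simp: g_def bij_betw_def)
  have "g (x + y) = g x + g y" if "x \<in> B" "y \<in> B" for x y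
    using gf[of "g x + g y"] f(2)[of "g x" "g y"] g that assms(2) by simp
  moreover have "g (sclB c x) = sclA c (g x)" if "x \<in> B" for c x
    using gf[of "sclA c (g x)"] f(3)[of "g x" c] g that assms(3) by simp
  moreover have "bij_betw g B A"
    unfolding g_def by (rule bij_betw_inv_into[OF f(1)])
  ultimately show ?thesis unfolding lin_isomorphic_def by blast
qed

text \<open>
  The inverse isomorphism sends \<open>(a + A', b, c, d)\<close> to \<open>a + b + c + d + I\<close>; it is the setwise sum
  of \<open>a + A'\<close> and \<open>b + c + d + I\<close>.
\<close>

lemma quot_sum_isomorphic:
  fixes scl :: "'k::field \<Rightarrow> 'v::ab_group_add \<Rightarrow> 'v"
  assumes scl: "vector_space scl" and dir: "direct_sum4 scl A B C D"
    and I: "module.subspace scl I" and A': "module.subspace scl A'" "A' \<subseteq> A" "A' \<subseteq> I"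
    and inter: "I \<inter> (A + B + C + D) \<subseteq> A'"
  shows "lin_isomorphic (quot_space (I + (A + B + C + D)) I) (quot_scale scl I)
     (quot_space A A' \<times> B \<times> C \<times> D)
     (\<lambda>k (X, b, c, d). (quot_scale scl A' k X, scl k b, scl k c, scl k d))"
proof -
  interpret vector_space scl by fact
  note mod = module_axioms
  have sub: "subspace A" "subspace B" "subspace C" "subspace D"
    using dir by (auto simp: direct_sum4_def)
  have indep: "a = 0 \<and> b = 0 \<and> c = 0 \<and> d = 0"
    if "a \<in> A" "b \<in> B" "c \<in> C" "d \<in> D" "a + b + c + d = 0" for a b c d
    using dir that by (auto simp: direct_sum4_def)
  let ?O = "quot_space A A' \<times> B \<times> C \<times> D"
  let ?sc = "\<lambda>k (X, b, c, d). (quot_scale scl A' k X, scl k b, scl k c, scl k d)"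
  define g where "g = (\<lambda>(X, b, c, d). X + ((b + c + d) +o I))"
  have g_eq: "g (a +o A', b, c, d) = (a + b + c + d) +o I" for a b c d
  proof -
    \<comment> \<open>\<open>A'\<close> is absorbed by \<open>I\<close>, so the setwise sum is a
      single coset of \<open>I\<close>, and no representative of \<open>a +o A'\<close> has to be
      chosen.\<close>
    have "(a +o A') + ((b + c + d) +o I) = (a + b + c + d) +o I"
    proof (intro equalityI subsetI)
      fix z assume "z \<in> (a +o A') + ((b + c + d) +o I)"
      then obtain u v where "u \<in> I" "v \<in> I" "z = (a + u) + (b + c + d + v)"
        using A'(3) by (auto simp: set_plus_def elt_set_plus_def)
      then show "z \<in> (a + b + c + d) +o I"
        using subspace_add[OF I] by (auto simp: elt_set_plus_def algebra_simps intro!: bexI[of _ "u + v"])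
    next
      fix z assume "z \<in> (a + b + c + d) +o I"
      then obtain u where "u \<in> I" "z = (a + 0) + (b + c + d + u)"
        by (auto simp: elt_set_plus_def algebra_simps)
      then show "z \<in> (a +o A') + ((b + c + d) +o I)"
        using subspace_0[OF A'(1)] unfolding set_plus_def elt_set_plus_def by blast
    qed
    then show ?thesis by (simp add: g_def)
  qed
  have O_cases: "\<exists>a\<in>A. \<exists>b\<in>B. \<exists>c\<in>C. \<exists>d\<in>D. u = (a +o A', b, c, d)" if "u \<in> ?O"
    for u
    using that by (auto simp: quot_space_def)
  have O_I: "(a +o A', b, c, d) \<in> ?O" if "a \<in> A" "b \<in> B" "c \<in> C" "d \<in> D" for a b c d
    using that by (auto simp: quot_space_def)
  have add_eq: "(a +o A', b, c, d) + (a' +o A', b', c', d') = ((a + a') +o A', b + b', c + c', d + d')"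
    for a a' b b' c c' d d'
    by (simp add: quot_add_coset[OF mod A'(1)])
  have sc_eq: "?sc k (a +o A', b, c, d) = (scl k a +o A', scl k b, scl k c, scl k d)" for k a b c d
    by (simp add: quot_scale_coset[OF mod A'(1)])
  have "inj_on g ?O"
  proof (rule inj_onI)
    fix u u' assume u: "u \<in> ?O" "u' \<in> ?O" and eq: "g u = g u'"
    obtain a b c d where 1: "a \<in> A" "b \<in> B" "c \<in> C" "d \<in> D" "u = (a +o A', b, c, d)"
      using O_cases[OF u(1)] by blast
    obtain a' b' c' d' where 2: "a' \<in> A" "b' \<in> B" "c' \<in> C" "d' \<in> D" "u' = (a' +o A', b', c', d')"
      using O_cases[OF u(2)] by blast
    \<comment> \<open>The difference \<open>e\<close> of the two sums lies in \<open>I\<close> and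
      in the sum of the four spaces, hence in \<open>A'\<close>, which is part of \<open>A\<close>.
      Moving it into the first summand leaves a vanishing sum, to which independence
      applies.\<close>
    define e where "e = (a - a') + (b - b') + (c - c') + (d - d')"
    have diffs: "a - a' \<in> A" "b - b' \<in> B" "c - c' \<in> C" "d - d' \<in> D"
      using 1 2 sub by (auto intro: subspace_diff)
    have "e \<in> A + B + C + D" unfolding e_def using diffs by (intro set_plus_intro)
    moreover have "e \<in> I"
      using eq 1 2 by (simp add: g_eq coset_eq_iff[OF mod I] e_def algebra_simps)
    ultimately have e: "e \<in> A'" using inter by blast
    have "(a - a' - e) + (b - b') + (c - c') + (d - d') = 0" by (simp add: e_def)
    moreover have "a - a' - e \<in> A" using e A'(2) diffs sub by (auto intro: subspace_diff)
    ultimately have "a - a' - e = 0 \<and> b - b' = 0 \<and> c - c' = 0 \<and> d - d' = 0"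
      using indep diffs by blast
    then show "u = u'" using 1 2 e by (simp add: coset_eq_iff[OF mod A'(1)])
  qed
  moreover have "g ` ?O = quot_space (I + (A + B + C + D)) I"
  proof (intro equalityI subsetI)
    fix z assume "z \<in> g ` ?O"
    then obtain a b c d where 1: "a \<in> A" "b \<in> B" "c \<in> C" "d \<in> D" "z = g (a +o A', b, c, d)"
      using O_cases by blast
    then have "0 + (a + b + c + d) \<in> I + (A + B + C + D)"
      using subspace_0[OF I] by (intro set_plus_intro)
    then show "z \<in> quot_space (I + (A + B + C + D)) I"
      using 1 by (auto simp: g_eq quot_space_def)
  next
    fix z assume "z \<in> quot_space (I + (A + B + C + D)) I"
    then obtain e a b c d where 1: "e \<in> I" "a \<in> A" "b \<in> B" "c \<in> C" "d \<in> D"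
      "z = (e + (a + b + c + d)) +o I"
      unfolding quot_space_def set_plus_def by blast
    then have "z = g (a +o A', b, c, d)"
      by (simp add: g_eq coset_eq_iff[OF mod I])
    then show "z \<in> g ` ?O" using O_I[OF 1(2-5)] by blast
  qed
  ultimately have bij: "bij_betw g ?O (quot_space (I + (A + B + C + D)) I)"
    by (simp add: bij_betw_def)
  have closed: "u + v \<in> ?O" "g (u + v) = g u + g v" if uv: "u \<in> ?O" "v \<in> ?O" for u v
  proof -
    obtain a b c d where 1: "a \<in> A" "b \<in> B" "c \<in> C" "d \<in> D" "u = (a +o A', b, c, d)"
      using O_cases[OF uv(1)] by blast
    obtain a' b' c' d' where 2: "a' \<in> A" "b' \<in> B" "c' \<in> C" "d' \<in> D" "v = (a' +o A', b', c', d')"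
      using O_cases[OF uv(2)] by blast
    show "u + v \<in> ?O" unfolding 1 2 add_eq using 1 2 sub by (intro O_I subspace_add)
    show "g (u + v) = g u + g v"
      unfolding 1 2 add_eq g_eq quot_add_coset[OF mod I] by (simp add: algebra_simps)
  qed
  have scaled: "?sc k u \<in> ?O" "g (?sc k u) = quot_scale scl I k (g u)" if u: "u \<in> ?O" for k u
  proof -
    obtain a b c d where 1: "a \<in> A" "b \<in> B" "c \<in> C" "d \<in> D" "u = (a +o A', b, c, d)"
      using O_cases[OF u] by blast
    show "?sc k u \<in> ?O" unfolding 1 sc_eq using 1 sub by (intro O_I subspace_scale)
    show "g (?sc k u) = quot_scale scl I k (g u)"
      unfolding 1 sc_eq g_eq quot_scale_coset[OF mod I] by (simp add: algebra_simps)
  qed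
  have "lin_isomorphic ?O ?sc (quot_space (I + (A + B + C + D)) I) (quot_scale scl I)"
    unfolding lin_isomorphic_def
    by (intro exI[of _ g] conjI ballI allI) (rule bij closed(2) scaled(2); assumption?)+
  then show ?thesis by (rule lin_isomorphic_sym[OF _ closed(1) scaled(1)])
qed

section \<open>Tensors and components\<close>

text \<open>In contrast to \<open>sv_tensor\<close> the index set is ignored, so that identities
  between tensors carry no side conditions on weights.\<close>

definition tens :: "sv_kind \<Rightarrow> 'k::field \<Rightarrow> 'k laurent \<Rightarrow> 'k sv" where
  "tens X \<mu> f = lin_ext (\<lambda>i. Poly_Mapping.single (X, \<mu>, i) 1) f"

text \<open>The dual of \<open>tens\<close>: the Laurent polynomial in front of X_\<mu>. Writing it
  with \<open>lin_ext\<close> gives linearity for free.\<close>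

definition cmp :: "sv_kind \<Rightarrow> 'k::field \<Rightarrow> 'k sv \<Rightarrow> 'k laurent" where
  "cmp X \<mu> x = lin_ext (\<lambda>(Y, \<nu>, i). if Y = X \<and> \<nu> = \<mu> then Poly_Mapping.single i 1 else 0) x"

lemma tens_single [simp]: "tens X \<mu> (Poly_Mapping.single i a) = Poly_Mapping.single (X, \<mu>, i) a"
  by (simp add: tens_def)

lemma tens_add: "tens X \<mu> (f + g) = tens X \<mu> f + tens X \<mu> g"
  by (simp add: tens_def lin_ext_add)

lemma tens_vscale: "tens X \<mu> (vscale c f) = vscale c (tens X \<mu> f)"
  by (simp add: tens_def lin_ext_vscale)

lemma tens_zero [simp]: "tens X \<mu> 0 = 0"
  using tens_add[of X \<mu> 0 0] by simp

lemma cmp_add: "cmp X \<mu> (x + y) = cmp X \<mu> x + cmp X \<mu> y"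
  by (simp add: cmp_def lin_ext_add)

lemma cmp_vscale: "cmp X \<mu> (vscale c x) = vscale c (cmp X \<mu> x)"
  by (simp add: cmp_def lin_ext_vscale)

lemma cmp_zero [simp]: "cmp X \<mu> 0 = 0"
  using cmp_add[of X \<mu> 0 0] by (metis add_cancel_right_right)

lemma cmp_uminus: "cmp X \<mu> (- x) = - cmp X \<mu> x"
  using cmp_add[of X \<mu> x "- x"] by (simp add: eq_neg_iff_add_eq_0 add.commute)

lemma cmp_diff: "cmp X \<mu> (x - y) = cmp X \<mu> x - cmp X \<mu> y"
  using cmp_add[of X \<mu> x "- y"] by (simp add: cmp_uminus)

lemma cmp_tens: "cmp X \<mu> (tens Y \<nu> f) = (if Y = X \<and> \<nu> = \<mu> then f else 0)"
  by (induction f rule: poly_mapping_additive_induct) (auto simp: cmp_def tens_add lin_ext_add)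

lemma lookup_cmp: "Poly_Mapping.lookup (cmp X \<mu> x) i = Poly_Mapping.lookup x (X, \<mu>, i)"
proof (induction x rule: poly_mapping_additive_induct)
  case (1 p a)
  then show ?case by (cases p) (auto simp: cmp_def lookup_single when_def)
qed (simp add: cmp_add lookup_add)

lemma cmp_eqI: "(\<And>X \<mu>. cmp X \<mu> x = cmp X \<mu> y) \<Longrightarrow> x = y"
proof (rule poly_mapping_eqI)
  fix p :: "'a sv_index" assume "\<And>X \<mu>. cmp X \<mu> x = cmp X \<mu> y"
  then show "Poly_Mapping.lookup x p = Poly_Mapping.lookup y p"
    by (cases p) (metis lookup_cmp)
qed

lemma tens_eq_iff [simp]: "tens X \<mu> f = tens X \<mu> g \<longleftrightarrow> f = g"
  by (metis (full_types) cmp_tens)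

text \<open>The structure constants: $[X_\mu f, Y_\nu g]$ = \<open>br_coeff X Y \<mu> \<nu>\<close> times the vector
  $Z_{\mu+\nu} fg$ with \<open>Z = br_kind X Y\<close>. For the vanishing brackets \<open>Z\<close> is a junk value.\<close>

fun br_kind :: "sv_kind \<Rightarrow> sv_kind \<Rightarrow> sv_kind" where
  "br_kind SVL Y = Y" | "br_kind X SVL = X" | "br_kind X Y = SVM"

fun br_coeff :: "sv_kind \<Rightarrow> sv_kind \<Rightarrow> 'k::field \<Rightarrow> 'k \<Rightarrow> 'k" where
  "br_coeff SVL SVL \<mu> \<nu> = \<nu> - \<mu>"
| "br_coeff SVL SVM \<mu> \<nu> = \<nu>"
| "br_coeff SVM SVL \<mu> \<nu> = - \<mu>"
| "br_coeff SVL SVY \<mu> \<nu> = \<nu> - \<mu> / 2"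
| "br_coeff SVY SVL \<mu> \<nu> = - (\<mu> - \<nu> / 2)"
| "br_coeff SVY SVY \<mu> \<nu> = \<nu> - \<mu>"
| "br_coeff _ _ \<mu> \<nu> = 0"

text \<open>The bracket is bilinear over the Laurent polynomials, so the table of
  \<open>sv_br\<close> on monomials extends to all coefficients.\<close>

lemma sv_bracket_tens:
  "sv_bracket (tens X \<mu> f) (tens Y \<nu> g) = vscale (br_coeff X Y \<mu> \<nu>) (tens (br_kind X Y) (\<mu> + \<nu>) (f * g))"
proof (induction f rule: poly_mapping_additive_induct)
  case (1 i a)
  show ?case
  proof (induction g rule: poly_mapping_additive_induct)
    case (1 j b)
    then show ?case
      by (cases X; cases Y) (simp_all add: sv_bracket_single mult_single mult.commute)
  qed (simp add: tens_add sv_bracket_add_right distrib_left vs.scale_right_distrib)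
qed (simp add: tens_add sv_bracket_add_left distrib_right vs.scale_right_distrib)

lemma sv_bracket_L0: "cmp X \<mu> (sv_bracket (tens SVL 0 1) x) = vscale \<mu> (cmp X \<mu> (x :: 'k::field sv))"
proof (induction x rule: poly_mapping_additive_induct)
  case (1 p a)
  obtain Y \<nu> j where p: "p = (Y, \<nu>, j)" by (cases p)
  have *: "Poly_Mapping.single p a = tens Y \<nu> (Poly_Mapping.single j a)" by (simp add: p)
  have "br_coeff SVL Y 0 \<nu> = \<nu>" by (cases Y) auto
  then show ?case unfolding * sv_bracket_tens by (auto simp: cmp_tens cmp_vscale simp del: tens_single)
qed (simp add: sv_bracket_add_right cmp_add vs.scale_right_distrib)

lemma sv_bracket_diff_left: "sv_bracket (x - y) z = sv_bracket x z - sv_bracket y z"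
  using sv_bracket_add_left[of "x - y" y z] by (simp add: eq_diff_eq)

lemma sv_bracket_diff_right: "sv_bracket x (y - z) = sv_bracket x y - sv_bracket x z"
  using sv_bracket_add_right[of x "y - z" z] by (simp add: eq_diff_eq)

lemma sv_bracket_uminus_left: "sv_bracket (- x) z = - sv_bracket x z"
  using sv_bracket_diff_left[of 0 x z] by simp

section \<open>The outer derivations\<close>

definition kind_weights :: "'k::field set \<Rightarrow> 'k \<Rightarrow> sv_kind \<Rightarrow> 'k set" where
  "kind_weights G s X = (if X = SVY then shifted G s else G)"

lemma sv_basis_iff: "(X, \<mu>, i) \<in> sv_basis G s \<longleftrightarrow> \<mu> \<in> kind_weights G s X"
  by (cases X) (auto simp: sv_basis_def kind_weights_def)

lemma sv_tensor_eq:
  "sv_tensor G s X \<mu> f = (if \<mu> \<in> kind_weights G s X then tens X \<mu> f else 0)"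
  by (auto simp: sv_tensor_def sv_vec_def sv_basis_iff tens_def lin_ext_def)

lemma sv_tensor_add: "sv_tensor G s X \<mu> (f + g) = sv_tensor G s X \<mu> f + sv_tensor G s X \<mu> g"
  by (simp add: sv_tensor_def lin_ext_add)

lemma sv_tensor_vscale: "sv_tensor G s X \<mu> (vscale c f) = vscale c (sv_tensor G s X \<mu> f)"
  by (simp add: sv_tensor_def lin_ext_vscale)

lemma sv_space_0: "0 \<in> sv_space G s"
  by (simp add: sv_space_def)

lemma sv_space_add: "x \<in> sv_space G s \<Longrightarrow> y \<in> sv_space G s \<Longrightarrow> x + y \<in> sv_space G s"
  using keys_add[of x y] by (auto simp: sv_space_def)

lemma sv_space_vscale: "x \<in> sv_space G s \<Longrightarrow> vscale c x \<in> sv_space G s"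
  by (auto simp: sv_space_def subset_iff in_keys_iff)

lemma sv_space_subspace: "vs.subspace (sv_space G s)"
  by (simp add: vs.subspace_def sv_space_0 sv_space_add sv_space_vscale)

lemma sv_space_iff_cmp:
  "x \<in> sv_space G s \<longleftrightarrow> (\<forall>X \<mu>. \<mu> \<notin> kind_weights G s X \<longrightarrow> cmp X \<mu> x = 0)"
proof -
  have "x \<in> sv_space G s \<longleftrightarrow>
    (\<forall>X \<mu> i. \<mu> \<notin> kind_weights G s X \<longrightarrow> Poly_Mapping.lookup (cmp X \<mu> x) i = 0)"
    unfolding lookup_cmp sv_basis_iff[symmetric, of _ _ "_ :: int"] sv_space_def
    by (auto simp: subset_iff in_keys_iff sv_basis_iff)
  also have "\<dots> \<longleftrightarrow> (\<forall>X \<mu>. \<mu> \<notin> kind_weights G s X \<longrightarrow> cmp X \<mu> x = 0)"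
    by (auto intro!: poly_mapping_eqI)
  finally show ?thesis .
qed

lemma tens_in_space: "\<mu> \<in> kind_weights G s X \<Longrightarrow> tens X \<mu> f \<in> sv_space G s"
  by (auto simp: sv_space_iff_cmp cmp_tens)

lemma sv_tensor_in_space: "sv_tensor G s X \<mu> f \<in> sv_space G s"
  by (simp add: sv_tensor_eq tens_in_space sv_space_0)

text \<open>An element is the finite sum of its basis terms. Membership is carried through the
  induction because maps such as derivations are additive only on the space.\<close>

lemma sv_space_induct [consumes 1, case_names zero tens add]:
  assumes "x \<in> sv_space G s" and "P 0"
    and tens: "\<And>X \<mu> f. \<mu> \<in> kind_weights G s X \<Longrightarrow> P (tens X \<mu> f)"
    and add: "\<And>x y. x \<in> sv_space G s \<Longrightarrow> y \<in> sv_space G s \<Longrightarrow> P x \<Longrightarrow> P y \<Longrightarrow> P (x + y)"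
  shows "P x"
proof -
  let ?m = "\<lambda>p. Poly_Mapping.single p (Poly_Mapping.lookup x p)"
  have m: "?m p \<in> sv_space G s \<and> P (?m p)" if "p \<in> Poly_Mapping.keys x" for p
  proof -
    obtain X \<mu> i where p: "p = (X, \<mu>, i)" by (cases p)
    have "\<mu> \<in> kind_weights G s X"
      using that assms(1) by (auto simp: sv_space_def p sv_basis_iff)
    then show ?thesis
      using tens tens_in_space tens_single unfolding p by metis
  qed
  have "sum ?m S \<in> sv_space G s \<and> P (sum ?m S)" if "finite S" "S \<subseteq> Poly_Mapping.keys x" for S
    using that
  proof (induction S)
    case (insert p S)
    then show ?case using m[of p] by (simp add: add sv_space_add)
  qed (simp add: sv_space_0 assms(2))
  from this[of "Poly_Mapping.keys x"] show ?thesis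
    using lin_ext_linear[of "\<lambda>y. y" x] by (simp add: lin_ext_def)
qed

interpretation fs: vector_space "fscale vscale"
  by (rule vector_space_fscale[OF vector_space_vscale])

text \<open>Tensors at admissible weights generate the space additively, and both maps are zero off
  it.\<close>

lemma endos_eqI:
  assumes "E \<in> endos vscale (sv_space G s)" "F \<in> endos vscale (sv_space G s)"
    and "\<And>X \<mu> f. \<mu> \<in> kind_weights G s X \<Longrightarrow> E (tens X \<mu> f) = F (tens X \<mu> f)"
  shows "E = F"
proof
  fix x
  have add: "H (u + v) = H u + H v" if "H \<in> {E, F}" "u \<in> sv_space G s" "v \<in> sv_space G s" for H u v
    using that assms(1,2) by (auto simp: endos_def)
  have "E 0 = 0" "F 0 = 0" using add[of _ 0 0] sv_space_0[of G s] by simp_all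
  show "E x = F x"
  proof (cases "x \<in> sv_space G s")
    case True
    then show ?thesis
      by (induction rule: sv_space_induct) (auto simp: \<open>E 0 = 0\<close> \<open>F 0 = 0\<close> assms(3) add)
  next
    case False
    then show ?thesis using assms(1,2) by (auto simp: endos_def)
  qed
qed

lemma endos_subspace: "fs.subspace (endos vscale (sv_space G s))"
  unfolding fs.subspace_def
  by (auto simp: endos_def fscale_def sv_space_0 sv_space_add sv_space_vscale image_subset_iff
      vs.scale_right_distrib vs.scale_left_commute algebra_simps)

lemma lin_ext_endos:
  assumes "\<And>p. v p \<in> sv_space G s"
  shows "on_space (sv_space G s) (lin_ext v) \<in> endos vscale (sv_space G s)"
proof -
  have "lin_ext v x \<in> sv_space G s" for x
    unfolding lin_ext_def
    by (intro vs.subspace_sum sv_space_subspace sv_space_vscale assms)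
  then show ?thesis
    by (auto simp: endos_def on_space_def sv_space_add sv_space_vscale lin_ext_add lin_ext_vscale)
qed

section \<open>Values of the outer derivations on tensors\<close>

lemma lin_ext_tens: "lin_ext v (tens X \<mu> f) = lin_ext (\<lambda>i. v (X, \<mu>, i)) f"
  by (induction f rule: poly_mapping_additive_induct) (auto simp: tens_add lin_ext_add)

lemma lin_ext_mult_tpow: "lin_ext (\<lambda>i. tens X \<mu> (h * tpow i)) f = tens X \<mu> (h * f)"
  unfolding tpow_def
  by (rule lin_ext_linear)
    (simp_all add: tens_add tens_vscale distrib_left vscale_mult_right)

lemma laurent_der_add: "\<rho> \<in> laurent_ders \<Longrightarrow> \<rho> (f + g) = \<rho> f + \<rho> g"
  and laurent_der_vscale: "\<rho> \<in> laurent_ders \<Longrightarrow> \<rho> (vscale c f) = vscale c (\<rho> f)"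
  and laurent_der_mult: "\<rho> \<in> laurent_ders \<Longrightarrow> \<rho> (f * g) = \<rho> f * g + f * \<rho> g"
  by (simp_all add: laurent_ders_iff)

text \<open>\<^const>\<open>D_b\<close> is a derivation because these factors are additive along nonzero brackets.\<close>

fun b_weight :: "sv_kind \<Rightarrow> 'k::field" where
  "b_weight SVL = 0" | "b_weight SVM = 1" | "b_weight SVY = 1 / 2"

lemma D_phi_tens:
  "\<mu> \<in> kind_weights G s X \<Longrightarrow> D_phi G s \<phi> (tens X \<mu> f) = tens X \<mu> (\<phi> \<mu> * f)"
  by (simp add: D_phi_def on_space_def tens_in_space lin_ext_tens sv_tensor_eq lin_ext_mult_tpow)

lemma lin_ext_zero_fun: "lin_ext (\<lambda>i. 0) f = 0"
  by (simp add: lin_ext_def)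

lemma D_g_tens:
  "\<mu> \<in> kind_weights G s X \<Longrightarrow>
    D_g G s g (tens X \<mu> f) = (if X = SVL then tens SVM \<mu> (g \<mu> * f) else 0)"
  by (cases X) (simp_all add: D_g_def on_space_def tens_in_space lin_ext_tens sv_tensor_eq
      lin_ext_mult_tpow lin_ext_zero_fun kind_weights_def)

lemma D_b_tens:
  "\<mu> \<in> kind_weights G s X \<Longrightarrow> D_b G s b (tens X \<mu> f) = tens X \<mu> (vscale (b_weight X) (b * f))"
  by (cases X) (simp_all add: D_b_def on_space_def tens_in_space lin_ext_tens sv_tensor_eq
      lin_ext_mult_tpow lin_ext_vscale_fun lin_ext_zero_fun tens_vscale)

lemma D_rho_tens:
  assumes "\<rho> \<in> laurent_ders" "\<mu> \<in> kind_weights G s X"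
  shows "D_rho G s \<rho> (tens X \<mu> f) = tens X \<mu> (\<rho> f)"
proof -
  have "lin_ext (\<lambda>i. tens X \<mu> (\<rho> (tpow i))) f = tens X \<mu> (\<rho> f)"
    unfolding tpow_def
    by (rule lin_ext_linear)
      (simp_all add: tens_add tens_vscale laurent_der_add[OF assms(1)] laurent_der_vscale[OF assms(1)])
  then show ?thesis
    using assms(2) by (simp add: D_rho_def on_space_def tens_in_space lin_ext_tens sv_tensor_eq)
qed

lemma D_endos:
  "D_phi G s \<phi> \<in> endos vscale (sv_space G s)" "D_g G s g \<in> endos vscale (sv_space G s)"
  "D_b G s b \<in> endos vscale (sv_space G s)" "D_rho G s \<rho> \<in> endos vscale (sv_space G s)"
  unfolding D_phi_def D_g_def D_b_def D_rho_def
  by (intro lin_ext_endos;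
      auto simp: sv_tensor_in_space sv_space_vscale sv_space_0 split: prod.splits sv_kind.splits)+

lemma lin_ext_add_cong: "(\<And>p. u p = v p + w p) \<Longrightarrow> lin_ext u x = lin_ext v x + lin_ext w x"
  using lin_ext_add_fun[of v w x] by presburger

lemma lin_ext_vscale_cong: "(\<And>p. u p = vscale c (v p)) \<Longrightarrow> lin_ext u x = vscale c (lin_ext v x)"
  using lin_ext_vscale_fun[of c v x] by presburger

text \<open>Each of the four families has this shape with \<open>v\<close> linear in the parameter,
  so that its members form the image of a parameter space under a linear map; this is how they are
  shown to be subspaces.\<close>

lemma on_space_linearI:
  assumes "\<And>a b p. v (a + b) p = v a p + v b p" "\<And>c a p. v (scl c a) p = vscale c (v a p)"
    and "vector_space scl"
  shows "Vector_Spaces.linear scl sv_fscale (\<lambda>a. on_space W (lin_ext (v a)))"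
  unfolding Vector_Spaces.linear_iff
  using assms fs.vector_space_axioms
  by (auto simp: on_space_def fscale_def fun_eq_iff lin_ext_add_cong[OF assms(1)]
      lin_ext_vscale_cong[OF assms(2)])

lemma D_phi_linear: "Vector_Spaces.linear (fscale vscale) sv_fscale (D_phi G s)"
  unfolding D_phi_def
  by (rule on_space_linearI)
    (auto simp: distrib_right sv_tensor_add fscale_def vscale_mult_left sv_tensor_vscale fs.vector_space_axioms)

lemma D_g_linear: "Vector_Spaces.linear (fscale vscale) sv_fscale (D_g G s)"
  unfolding D_g_def
  by (rule on_space_linearI)
    (auto simp: distrib_right sv_tensor_add fscale_def vscale_mult_left sv_tensor_vscale
      fs.vector_space_axioms split: sv_kind.split)

lemma D_b_linear: "Vector_Spaces.linear vscale sv_fscale (D_b G s)"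
  unfolding D_b_def
  by (rule on_space_linearI)
    (auto simp: distrib_right sv_tensor_add fscale_def vscale_mult_left sv_tensor_vscale
      vs.vector_space_axioms vs.scale_right_distrib split: sv_kind.split)

lemma D_rho_linear: "Vector_Spaces.linear (fscale vscale) sv_fscale (D_rho G s)"
  unfolding D_rho_def
  by (rule on_space_linearI)
    (auto simp: sv_tensor_add fscale_def sv_tensor_vscale fs.vector_space_axioms)

lemma hom_weights_subspace: "fs.subspace (hom_weights G s)"
  by (auto simp: fs.subspace_def hom_weights_def fscale_def vs.scale_right_distrib)

text \<open>The parameter space whose image under \<open>D_phi\<close> is
  \<open>DD_Hom'\<close>.\<close>

lemma hom_weights_scalar_subspace:
  "fs.subspace (hom_weights G s \<inter> {\<phi>. \<exists>f. \<forall>\<gamma>\<in>weights G s. \<phi> \<gamma> = vscale \<gamma> f})" (is "fs.subspace (_ \<inter> ?S)")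
proof (intro fs.subspace_inter hom_weights_subspace fs.subspaceI)
  show "0 \<in> ?S" by (intro CollectI exI[of _ 0]) simp
next
  fix \<phi> \<psi> assume "\<phi> \<in> ?S" "\<psi> \<in> ?S"
  then obtain f g where "\<forall>\<gamma>\<in>weights G s. \<phi> \<gamma> = vscale \<gamma> f" "\<forall>\<gamma>\<in>weights G s. \<psi> \<gamma> = vscale \<gamma> g" by blast
  then show "\<phi> + \<psi> \<in> ?S"
    by (intro CollectI exI[of _ "f + g"]) (simp add: vs.scale_right_distrib)
next
  fix c \<phi> assume "\<phi> \<in> ?S"
  then obtain f where "\<forall>\<gamma>\<in>weights G s. \<phi> \<gamma> = vscale \<gamma> f" by blast
  then show "fscale vscale c \<phi> \<in> ?S"
    by (intro CollectI exI[of _ "vscale c f"]) (simp add: fscale_def mult.commute)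
qed

lemma g_space_subspace: "fs.subspace (g_space G)"
proof -
  have "fscale vscale c g \<in> g_space G" if "g \<in> g_space G" for c g
  proof -
    have "vscale (\<beta> - \<alpha>) (vscale c (g (\<alpha> + \<beta>))) = vscale \<beta> (vscale c (g \<beta>)) - vscale \<alpha> (vscale c (g \<alpha>))"
      if "\<alpha> \<in> G" "\<beta> \<in> G" for \<alpha> \<beta>
    proof -
      have "vscale c (vscale (\<beta> - \<alpha>) (g (\<alpha> + \<beta>))) = vscale c (vscale \<beta> (g \<beta>) - vscale \<alpha> (g \<alpha>))"
        using \<open>g \<in> g_space G\<close> that by (simp add: g_space_def)
      then show ?thesis by (simp add: vs.scale_right_diff_distrib mult.commute)
    qed
    then show ?thesis by (simp add: g_space_def fscale_def)
  qed
  then show ?thesis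
    by (auto simp: fs.subspace_def g_space_def vs.scale_right_distrib)
qed

lemma laurent_ders_subspace: "fs.subspace laurent_ders"
  by (auto simp: fs.subspace_def laurent_ders_iff fscale_def vs.scale_right_distrib
      vscale_mult_left vscale_mult_right algebra_simps)

lemma subspace_linear_image:
  "Vector_Spaces.linear s1 s2 f \<Longrightarrow> module.subspace s1 S \<Longrightarrow> module.subspace s2 (f ` S)"
  by (metis module_hom.subspace_image module_hom_iff_linear)

lemma DD_Hom_eq: "DD_Hom G s = D_phi G s ` hom_weights G s"
  by (auto simp: DD_Hom_def)

lemma DD_g_eq: "DD_g G s = D_g G s ` g_space G"
proof -
  have "{D_g G s g | g. g \<in> g_space G} = D_g G s ` g_space G" by auto
  then show ?thesis
    using subspace_linear_image[OF D_g_linear g_space_subspace, of G]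
    by (simp add: DD_g_def fs.span_eq_iff)
qed

lemma DD_rho_eq: "DD_rho G s = D_rho G s ` laurent_ders"
  by (auto simp: DD_rho_def)

lemma DD_subspaces:
  "fs.subspace (DD_Hom G s)" "fs.subspace (DD_Hom' G s)" "fs.subspace (DD_g G s)"
  "fs.subspace (DD_b G s)" "fs.subspace (DD_rho G s)"
proof -
  show "fs.subspace (DD_Hom G s)"
    unfolding DD_Hom_eq by (rule subspace_linear_image[OF D_phi_linear hom_weights_subspace])
  have "DD_Hom' G s =
      D_phi G s ` (hom_weights G s \<inter> {\<phi>. \<exists>f. \<forall>\<gamma>\<in>weights G s. \<phi> \<gamma> = vscale \<gamma> f})"
    by (auto simp: DD_Hom'_def)
  then show "fs.subspace (DD_Hom' G s)"
    using subspace_linear_image[OF D_phi_linear hom_weights_scalar_subspace[of G s], of G s] by simp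
  show "fs.subspace (DD_g G s)"
    unfolding DD_g_eq by (rule subspace_linear_image[OF D_g_linear g_space_subspace])
  have "DD_b G s = D_b G s ` UNIV" by (auto simp: DD_b_def)
  then show "fs.subspace (DD_b G s)"
    using subspace_linear_image[OF D_b_linear vs.subspace_UNIV, of G s] by simp
  show "fs.subspace (DD_rho G s)"
    unfolding DD_rho_eq by (rule subspace_linear_image[OF D_rho_linear laurent_ders_subspace])
qed

lemma sv_Der_iff:
  "D \<in> sv_Der G s \<longleftrightarrow> D \<in> endos vscale (sv_space G s) \<and>
    (\<forall>x\<in>sv_space G s. \<forall>y\<in>sv_space G s. D (sv_bracket x y) = sv_bracket (D x) y + sv_bracket x (D y))"
  by (simp add: sv_Der_def derivations_def)

lemma endosD:
  assumes "F \<in> endos vscale (sv_space G s)" "x \<in> sv_space G s"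
  shows "F x \<in> sv_space G s" "F (vscale c x) = vscale c (F x)"
    "y \<in> sv_space G s \<Longrightarrow> F (x + y) = F x + F y"
  using assms by (auto simp: endos_def)

section \<open>Derivations on homogeneous tensors\<close>

locale sv_weights =
  fixes G :: "'k::field_char_0 set" and s :: 'k
  assumes subgroup: "is_add_subgroup G" and s_notin: "s \<notin> G" and double_s: "2 * s \<in> G"
begin

abbreviation W :: "'k sv set" where "W \<equiv> sv_space G s"
abbreviation wt :: "sv_kind \<Rightarrow> 'k set" where "wt \<equiv> kind_weights G s"
abbreviation ad :: "'k sv \<Rightarrow> 'k sv \<Rightarrow> 'k sv" where "ad z \<equiv> on_space W (sv_bracket z)"

lemma zero_in [simp]: "0 \<in> G" and add_in: "\<alpha> \<in> G \<Longrightarrow> \<beta> \<in> G \<Longrightarrow> \<alpha> + \<beta> \<in> G"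
  and minus_in: "\<alpha> \<in> G \<Longrightarrow> - \<alpha> \<in> G"
  using subgroup by (auto simp: is_add_subgroup_def)

lemma diff_in: "\<alpha> \<in> G \<Longrightarrow> \<beta> \<in> G \<Longrightarrow> \<alpha> - \<beta> \<in> G"
  using add_in[of \<alpha> "- \<beta>"] minus_in[of \<beta>] by simp

lemma shifted_iff: "\<mu> \<in> shifted G s \<longleftrightarrow> \<mu> - s \<in> G"
  by (auto simp: shifted_def image_iff intro!: bexI[of _ "\<mu> - s"])

lemma shifted_add: "\<alpha> \<in> G \<Longrightarrow> \<nu> \<in> shifted G s \<Longrightarrow> \<alpha> + \<nu> \<in> shifted G s"
  using add_in[of \<alpha> "\<nu> - s"] by (simp add: shifted_iff algebra_simps)

lemma shifted_shifted_add: "\<mu> \<in> shifted G s \<Longrightarrow> \<nu> \<in> shifted G s \<Longrightarrow> \<mu> + \<nu> \<in> G"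
  using add_in[OF add_in[of "\<mu> - s" "\<nu> - s"] double_s] by (simp add: shifted_iff algebra_simps)

lemma shifted_minus: "\<nu> \<in> shifted G s \<Longrightarrow> - \<nu> \<in> shifted G s"
  using diff_in[OF minus_in[of "\<nu> - s"] double_s] by (simp add: shifted_iff algebra_simps)

lemma shifted_disjoint: "\<mu> \<in> shifted G s \<Longrightarrow> \<mu> \<notin> G"
  using diff_in[of \<mu> "\<mu> - s"] s_notin by (auto simp: shifted_iff)

lemma s_nonzero: "s \<noteq> 0"
  using s_notin by auto

lemma shifted_nonzero: "\<nu> \<in> shifted G s \<Longrightarrow> \<nu> \<noteq> 0"
  using shifted_disjoint zero_in by blast

text \<open>The nonzero constant excludes the pair of M and Y, for which the junk kind
  \<open>SVM\<close> would get a weight outside \<open>G\<close>.\<close>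

lemma weights_br_kind:
  assumes "\<mu> \<in> wt X" "\<nu> \<in> wt Y" "br_coeff X Y \<mu> \<nu> \<noteq> 0"
  shows "\<mu> + \<nu> \<in> wt (br_kind X Y)"
  using assms add_in[of \<mu> \<nu>] shifted_add[of \<mu> \<nu>] shifted_add[of \<nu> \<mu>] shifted_shifted_add[of \<mu> \<nu>]
  by (cases X; cases Y) (auto simp: kind_weights_def add.commute)

lemma bracket_in: "x \<in> W \<Longrightarrow> y \<in> W \<Longrightarrow> sv_bracket x y \<in> W"
  by (rule sv_bracket_closed[OF subgroup double_s])

lemma sv_DerI:
  assumes F: "F \<in> endos vscale W"
    and tens: "\<And>X Y \<mu> \<nu> f g. \<mu> \<in> wt X \<Longrightarrow> \<nu> \<in> wt Y \<Longrightarrow>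
      F (sv_bracket (tens X \<mu> f) (tens Y \<nu> g)) =
      sv_bracket (F (tens X \<mu> f)) (tens Y \<nu> g) + sv_bracket (tens X \<mu> f) (F (tens Y \<nu> g))"
  shows "F \<in> sv_Der G s"
proof -
  note add = endosD(3)[OF F]
  have F0: "F 0 = 0" using add[OF sv_space_0 sv_space_0] by simp
  have "F (sv_bracket x y) = sv_bracket (F x) y + sv_bracket x (F y)" if "x \<in> W" "y \<in> W" for x y
    using that
  proof (induction arbitrary: y rule: sv_space_induct)
    case zero
    then show ?case by (simp add: F0)
  next
    case (tens X \<mu> f)
    note X = tens(1)
    show ?case using tens(2)
    proof (induction rule: sv_space_induct)
      case zero
      then show ?case by (simp add: F0)
    next
      case (tens Y \<nu> g)
      then show ?case using assms(2) X by blast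
    next
      case (add x y)
      then show ?case
        by (simp add: sv_bracket_add_right endosD(3)[OF F] bracket_in tens_in_space X algebra_simps)
    qed
  next
    case (add x x')
    then show ?case
      by (simp add: sv_bracket_add_left endosD(3)[OF F] bracket_in algebra_simps)
  qed
  then show ?thesis using F by (simp add: sv_Der_iff)
qed

text \<open>A map that preserves kind and weight sends commuting homogeneous tensors with vanishing
  structure constant to such tensors again, so the Leibniz rule has content only where the constant
  is nonzero. Multiplications and derivations of the loop variable all fit this pattern.\<close>

lemma diagonal_sv_DerI:
  assumes F: "F \<in> endos vscale W"
    and d: "\<And>X \<mu> f. \<mu> \<in> wt X \<Longrightarrow> F (tens X \<mu> f) = tens X \<mu> (d X \<mu> f)"
    and leib: "\<And>X Y \<mu> \<nu> f g. \<mu> \<in> wt X \<Longrightarrow> \<nu> \<in> wt Y \<Longrightarrow> br_coeff X Y \<mu> \<nu> \<noteq> 0 \<Longrightarrow>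
      d (br_kind X Y) (\<mu> + \<nu>) (f * g) = d X \<mu> f * g + f * d Y \<nu> g"
  shows "F \<in> sv_Der G s"
proof (rule sv_DerI[OF F])
  fix X Y \<mu> \<nu> and f g :: "'k laurent"
  assume w: "\<mu> \<in> wt X" "\<nu> \<in> wt Y"
  have F0: "F 0 = 0" using endosD(3)[OF F sv_space_0 sv_space_0] by simp
  show "F (sv_bracket (tens X \<mu> f) (tens Y \<nu> g)) =
      sv_bracket (F (tens X \<mu> f)) (tens Y \<nu> g) + sv_bracket (tens X \<mu> f) (F (tens Y \<nu> g))"
  proof (cases "br_coeff X Y \<mu> \<nu> = 0")
    case True
    then show ?thesis by (simp add: sv_bracket_tens d w F0)
  next
    case False
    note k = weights_br_kind[OF w False]
    show ?thesis
      by (simp add: sv_bracket_tens d w endosD(2)[OF F tens_in_space[OF k]] d[OF k]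
          leib[OF w False] tens_add vs.scale_right_distrib)
  qed
qed

lemma wt_subset_weights: "\<mu> \<in> wt X \<Longrightarrow> \<mu> \<in> weights G s"
  by (auto simp: kind_weights_def weights_def split: if_splits)

lemma D_phi_in_Der: "\<phi> \<in> hom_weights G s \<Longrightarrow> D_phi G s \<phi> \<in> sv_Der G s"
  by (rule diagonal_sv_DerI[where d = "\<lambda>X \<mu> f. \<phi> \<mu> * f"])
    (auto simp: D_endos D_phi_tens hom_weights_def wt_subset_weights algebra_simps)

lemma D_rho_in_Der: "\<rho> \<in> laurent_ders \<Longrightarrow> D_rho G s \<rho> \<in> sv_Der G s"
  by (rule diagonal_sv_DerI[where d = "\<lambda>X \<mu>. \<rho>"])
    (auto simp: D_endos D_rho_tens laurent_der_mult)

lemma b_weight_br: "br_coeff X Y \<mu> \<nu> \<noteq> 0 \<Longrightarrow> b_weight (br_kind X Y) = b_weight X + (b_weight Y :: 'k)"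
  by (cases X; cases Y) auto

lemma D_b_in_Der: "D_b G s b \<in> sv_Der G s"
  by (rule diagonal_sv_DerI[where d = "\<lambda>X \<mu> f. vscale (b_weight X) (b * f)"])
    (auto simp: D_endos D_b_tens b_weight_br vs.scale_left_distrib vscale_mult_left vscale_mult_right
      algebra_simps)

text \<open>\<open>D_g\<close> maps L to M and kills the rest, while M commutes with M and Y. So all
  brackets other than [L, L] contribute zero on both sides, and on [L, L] the Leibniz rule is the
  defining identity of \<open>g_space\<close>.\<close>

lemma D_g_in_Der:
  assumes "g \<in> g_space G"
  shows "D_g G s g \<in> sv_Der G s"
proof (rule sv_DerI[OF D_endos(2)])
  fix X Y \<mu> \<nu> and f h :: "'k laurent"
  assume w: "\<mu> \<in> wt X" "\<nu> \<in> wt Y"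
  have F0: "D_g G s g 0 = 0" using endosD(3)[OF D_endos(2) sv_space_0 sv_space_0] by simp
  show "D_g G s g (sv_bracket (tens X \<mu> f) (tens Y \<nu> h)) =
      sv_bracket (D_g G s g (tens X \<mu> f)) (tens Y \<nu> h) + sv_bracket (tens X \<mu> f) (D_g G s g (tens Y \<nu> h))"
  proof (cases "br_coeff X Y \<mu> \<nu> = 0 \<or> X \<noteq> SVL \<or> Y \<noteq> SVL")
    case True
    have "D_g G s g (sv_bracket (tens X \<mu> f) (tens Y \<nu> h)) = 0 \<or> (X = SVL \<and> Y = SVL)"
      using weights_br_kind[OF w]
      by (cases "br_coeff X Y \<mu> \<nu> = 0"; cases X; cases Y)
        (auto simp: sv_bracket_tens F0 endosD(2)[OF D_endos(2)] tens_in_space D_g_tens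
          simp del: vs.scale_minus_left)
    then show ?thesis
      using True w by (cases X; cases Y) (auto simp: D_g_tens sv_bracket_tens F0 mult.commute)
  next
    case False
    then have 1: "X = SVL" "Y = SVL" "\<mu> \<in> G" "\<nu> \<in> G" "\<mu> + \<nu> \<in> wt SVL"
      using w add_in by (auto simp: kind_weights_def)
    have "vscale (\<nu> - \<mu>) (g (\<mu> + \<nu>) * (f * h)) = vscale (\<nu> - \<mu>) (g (\<mu> + \<nu>)) * (f * h)"
      by (simp only: vscale_mult_left)
    also have "\<dots> = (vscale \<nu> (g \<nu>) - vscale \<mu> (g \<mu>)) * (f * h)"
      using assms 1 by (simp add: g_space_def)
    finally have "vscale (\<nu> - \<mu>) (g (\<mu> + \<nu>) * (f * h)) =
        vscale (- \<mu>) (g \<mu> * f * h) + vscale \<nu> (f * (g \<nu> * h))"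
      by (simp add: vscale_mult_right right_diff_distrib mult_ac)
    then show ?thesis
      using w 1 by (simp add: sv_bracket_tens endosD(2)[OF D_endos(2)] tens_in_space D_g_tens
          tens_vscale[symmetric] tens_add[symmetric] vscale_mult_right)
  qed
qed

lemma ad_in_Der: "z \<in> W \<Longrightarrow> ad z \<in> sv_Der G s"
proof -
  assume z: "z \<in> W"
  have "sv_bracket z (sv_bracket x y) = sv_bracket (sv_bracket z x) y + sv_bracket x (sv_bracket z y)" for x y
    using sv_bracket_jacobi[of z x y] sv_bracket_antisym[of "sv_bracket z x" y]
      sv_bracket_antisym[of y z] sv_bracket_diff_right[of x 0 "sv_bracket z y"]
    by (simp add: algebra_simps)
  then show ?thesis
    using z by (auto simp: sv_Der_iff endos_def on_space_def bracket_in sv_space_add sv_space_vscale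
        sv_bracket_add_right sv_bracket_vscale_right)
qed

section \<open>Inner derivations and the identification of the first cohomology\<close>

lemma sv_ad_eq: "sv_ad G s = {ad z | z. z \<in> W}"
  by (auto simp: sv_ad_def inner_derivations_def)

lemma sv_Der_subspace: "fs.subspace (sv_Der G s)"
  using endos_subspace[of G s]
  by (auto simp: fs.subspace_def sv_Der_iff fscale_def sv_bracket_add_left sv_bracket_add_right
      sv_bracket_vscale_left sv_bracket_vscale_right vs.scale_right_distrib algebra_simps)

lemma sv_ad_subspace: "fs.subspace (sv_ad G s)"
proof -
  have "Vector_Spaces.linear vscale sv_fscale ad"
    by (auto simp: Vector_Spaces.linear_iff vs.vector_space_axioms fs.vector_space_axioms on_space_def
        fscale_def fun_eq_iff sv_bracket_add_left sv_bracket_vscale_left)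
  from subspace_linear_image[OF this sv_space_subspace[of G s]] show ?thesis
    by (simp add: sv_ad_eq image_def Bex_def conj_commute Setcompr_eq_image)
qed

text \<open>With adjoint coefficients, antisymmetry turns the vanishing of \<open>ce_d1\<close> into
  the Leibniz rule.\<close>

lemma cocycles1_eq: "cocycles1 vscale sv_bracket W = sv_Der G s"
proof -
  have "ce_d1 sv_bracket f x y = 0 \<longleftrightarrow> f (sv_bracket x y) = sv_bracket (f x) y + sv_bracket x (f y)"
    for f :: "'k sv \<Rightarrow> 'k sv" and x y
    using sv_bracket_antisym[of y "f x"] by (auto simp: ce_d1_def algebra_simps)
  then show ?thesis by (auto simp: cocycles1_def sv_Der_iff)
qed

text \<open>The differential brackets with \<open>v\<close> on the right, so it is the inner
  derivation of \<open>- v\<close>; the sign is absorbed by the space.\<close>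

lemma coboundaries1_eq: "coboundaries1 sv_bracket W = sv_ad G s"
proof -
  have eq: "ce_d0 sv_bracket W v = ad (- v)" for v
    using sv_bracket_antisym[of _ v]
    by (auto simp: ce_d0_def on_space_def fun_eq_iff sv_bracket_uminus_left)
  have "- v \<in> W" if "v \<in> W" for v
    using that sv_space_subspace[of G s] by (simp add: vs.subspace_neg)
  then show ?thesis
    unfolding coboundaries1_def sv_ad_eq eq image_def by (metis (no_types, opaque_lifting) minus_minus)
qed

text \<open>The M-part drops out because the constant of [M_\<alpha>, L_\<beta>] is -\<alpha>, which
  vanishes at weight 0 whatever \<beta> is.\<close>

lemma ad_weight_zero:
  "ad (tens SVL 0 a + tens SVM 0 h) = D_phi G s (\<lambda>\<mu>. vscale \<mu> a)"
proof (rule endos_eqI)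
  have "tens SVL 0 a + tens SVM 0 h \<in> W"
    by (intro sv_space_add tens_in_space) (auto simp: kind_weights_def)
  then show "ad (tens SVL 0 a + tens SVM 0 h) \<in> endos vscale W"
    using ad_in_Der sv_Der_iff by blast
  fix X \<mu> f assume "\<mu> \<in> wt X"
  then show "ad (tens SVL 0 a + tens SVM 0 h) (tens X \<mu> f) = D_phi G s (\<lambda>\<mu>. vscale \<mu> a) (tens X \<mu> f)"
    by (cases X) (auto simp: on_space_def tens_in_space sv_bracket_add_left sv_bracket_tens D_phi_tens
        tens_vscale vscale_mult_left)
qed (rule D_endos)

lemma D_phi_cong:
  assumes "\<And>\<mu>. \<mu> \<in> weights G s \<Longrightarrow> \<phi> \<mu> = \<psi> \<mu>"
  shows "D_phi G s \<phi> = D_phi G s \<psi>"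
  by (rule endos_eqI[OF D_endos(1) D_endos(1)]) (simp add: D_phi_tens assms wt_subset_weights)

lemma DD_Hom'_eq: "DD_Hom' G s = {D_phi G s (\<lambda>\<mu>. vscale \<mu> f) | f. True}"
proof -
  have "(\<lambda>\<mu>. vscale \<mu> f) \<in> hom_weights G s" for f
    by (simp add: hom_weights_def vs.scale_left_distrib)
  then show ?thesis
    unfolding DD_Hom'_def by (auto intro: D_phi_cong)
qed

lemma DD_Hom'_subset_ad: "DD_Hom' G s \<subseteq> sv_ad G s"
proof -
  have "tens SVL 0 f \<in> W" for f by (rule tens_in_space) (simp add: kind_weights_def)
  then show ?thesis
    unfolding DD_Hom'_eq sv_ad_eq using ad_weight_zero[of _ 0, symmetric, simplified] by blast
qed

lemma outer_elim:
  assumes "D \<in> DD_Hom G s + DD_g G s + DD_b G s + DD_rho G s"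
  obtains \<phi> g b \<rho> where "\<phi> \<in> hom_weights G s" "g \<in> g_space G" "\<rho> \<in> laurent_ders"
    "D = D_phi G s \<phi> + D_g G s g + D_b G s b + D_rho G s \<rho>"
  using assms unfolding set_plus_def DD_Hom_eq DD_g_eq DD_b_def DD_rho_eq by blast

text \<open>Evaluation at L_{0,0} determines where \<open>z\<close> lives: the outer part keeps this
  vector in weight 0, whereas [z, L_{0,0}] has the component -\<mu> z_\<mu> at weight \<mu>. So
  \<open>z\<close> has weight 0, which is no weight of Y.\<close>

lemma ad_inter_outer:
  "sv_ad G s \<inter> (DD_Hom G s + DD_g G s + DD_b G s + DD_rho G s) \<subseteq> DD_Hom' G s"
proof
  fix D assume D: "D \<in> sv_ad G s \<inter> (DD_Hom G s + DD_g G s + DD_b G s + DD_rho G s)"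
  then obtain z where z: "z \<in> W" "D = ad z" by (auto simp: sv_ad_eq)
  from D obtain \<phi> g b \<rho> where E: "\<rho> \<in> laurent_ders"
    "D = D_phi G s \<phi> + D_g G s g + D_b G s b + D_rho G s \<rho>"
    by (blast elim: outer_elim)
  have L0: "0 \<in> wt SVL" "0 \<in> wt SVM" by (auto simp: kind_weights_def)
  have "cmp X \<mu> z = 0" if "\<mu> \<noteq> 0" for X \<mu>
  proof -
    have "cmp X \<mu> (D (tens SVL 0 1)) = 0"
      using that by (simp add: E D_phi_tens D_g_tens D_b_tens D_rho_tens L0 cmp_add cmp_tens)
    moreover have "D (tens SVL 0 1) = - sv_bracket (tens SVL 0 1) z"
      using sv_bracket_antisym[of z "tens SVL 0 1"] by (simp add: z on_space_def tens_in_space L0)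
    ultimately show ?thesis using that by (simp add: cmp_uminus sv_bracket_L0)
  qed
  moreover have "0 \<notin> wt SVY" by (auto simp: kind_weights_def dest: shifted_nonzero)
  with z(1) have "cmp SVY 0 z = 0" by (simp add: sv_space_iff_cmp)
  ultimately have "cmp X \<mu> z = cmp X \<mu> (tens SVL 0 (cmp SVL 0 z) + tens SVM 0 (cmp SVM 0 z))" for X \<mu>
    by (cases X; cases "\<mu> = 0") (simp_all add: cmp_add cmp_tens)
  then have "z = tens SVL 0 (cmp SVL 0 z) + tens SVM 0 (cmp SVM 0 z)" by (rule cmp_eqI)
  then show "D \<in> DD_Hom' G s"
    unfolding z(2) DD_Hom'_eq using ad_weight_zero by (metis (mono_tags, lifting) mem_Collect_eq)
qed

text \<open>Weight 0 separates the summands. Additivity gives \<open>\<phi> 0 = 0\<close>, so L_0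
  isolates \<rho> and then M_0 isolates b; g is read off from the M-component on L_\<alpha>. What
  remains at each weight is \<phi>.\<close>

lemma outer_direct: "direct_sum4 sv_fscale (DD_Hom G s) (DD_g G s) (DD_b G s) (DD_rho G s)"
proof -
  have "D_phi G s \<phi> = 0 \<and> D_g G s g = 0 \<and> D_b G s b = 0 \<and> D_rho G s \<rho> = 0"
    if hom: "\<phi> \<in> hom_weights G s" and \<rho>: "\<rho> \<in> laurent_ders"
      and zero: "D_phi G s \<phi> + D_g G s g + D_b G s b + D_rho G s \<rho> = 0" for \<phi> g b \<rho>
  proof -
    have eq: "tens X \<mu> (\<phi> \<mu> * f) + (if X = SVL then tens SVM \<mu> (g \<mu> * f) else 0) +
        tens X \<mu> (vscale (b_weight X) (b * f)) + tens X \<mu> (\<rho> f) = 0" if "\<mu> \<in> wt X" for X \<mu> f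
      using fun_cong[OF zero, of "tens X \<mu> f"] that
      by (simp add: D_phi_tens D_g_tens D_b_tens D_rho_tens[OF \<rho>])
    have "\<phi> (0 + 0) = \<phi> 0 + \<phi> 0"
      using hom zero_in unfolding hom_weights_def weights_def by blast
    then have phi0: "\<phi> 0 = 0" by simp
    have L: "\<phi> \<alpha> * f + \<rho> f = 0" "g \<alpha> * f = 0" if "\<alpha> \<in> G" for \<alpha> f
      using arg_cong[OF eq[of \<alpha> SVL f], of "cmp SVL \<alpha>"] arg_cong[OF eq[of \<alpha> SVL f], of "cmp SVM \<alpha>"] that
      by (auto simp: kind_weights_def cmp_add cmp_tens)
    have rho0: "\<rho> f = 0" for f using L(1)[of 0 f] phi0 by simp
    have g0: "g \<alpha> = 0" if "\<alpha> \<in> G" for \<alpha> using L(2)[OF that, of 1] by simp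
    have b0: "b = 0"
      using arg_cong[OF eq[of 0 SVM 1], of "cmp SVM 0"]
      by (simp add: kind_weights_def cmp_add cmp_tens phi0 rho0)
    have "\<phi> \<mu> = 0" if "\<mu> \<in> wt X" for X \<mu>
      using arg_cong[OF eq[OF that, of 1], of "cmp X \<mu>"]
      by (cases X) (auto simp: cmp_add cmp_tens rho0 b0)
    then have "D_phi G s \<phi> = 0"
      using fs.subspace_0[OF endos_subspace[of G s]]
      by (intro endos_eqI[OF D_endos(1)]) (auto simp: D_phi_tens)
    moreover have "D_g G s g = 0"
      using fs.subspace_0[OF endos_subspace[of G s]] g0
      by (intro endos_eqI[OF D_endos(2)]) (auto simp: D_g_tens kind_weights_def)
    moreover have "D_b G s b = 0"
      using fs.subspace_0[OF endos_subspace[of G s]] b0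
      by (intro endos_eqI[OF D_endos(3)]) (auto simp: D_b_tens)
    moreover have "D_rho G s \<rho> = 0"
      using fs.subspace_0[OF endos_subspace[of G s]] rho0
      by (intro endos_eqI[OF D_endos(4)]) (auto simp: D_rho_tens[OF \<rho>])
    ultimately show ?thesis by blast
  qed
  then show ?thesis
    unfolding direct_sum4_def using DD_subspaces[of G s]
    by (auto simp: DD_Hom_eq DD_g_eq DD_b_def DD_rho_eq)
qed

section \<open>Derivations preserving the weights\<close>

text \<open>Rests on 3 \<noteq> 0 in the field; it keeps the detours through 2\<alpha> and -\<alpha>
  away from the exceptional pairs.\<close>

lemma double_neq: "\<alpha> \<noteq> 0 \<Longrightarrow> \<alpha> + \<alpha> \<noteq> - (\<alpha> :: 'k)"
proof
  assume "\<alpha> \<noteq> 0" "\<alpha> + \<alpha> = - \<alpha>"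
  then have "3 * \<alpha> = 0" by (simp add: eq_neg_iff_add_eq_0 algebra_simps)
  with \<open>\<alpha> \<noteq> 0\<close> show False by simp
qed

text \<open>Both s and -s are weights of Y, and they differ. With \<gamma> = \<alpha> / 2 this
  supplies a Y_\<nu> on which L_\<alpha> acts by a nonzero constant.\<close>

lemma exists_shifted_neq: "\<exists>\<nu>\<in>shifted G s. \<nu> \<noteq> \<gamma>"
proof -
  have "s \<in> shifted G s" by (simp add: shifted_iff)
  moreover have "- s \<in> shifted G s" using calculation by (rule shifted_minus)
  moreover have "s \<noteq> - s" using s_nonzero by (simp add: eq_neg_iff_add_eq_0 mult_2[symmetric])
  ultimately show ?thesis by metis
qed

text \<open>\<open>P \<alpha>\<close> is the operator on L_\<alpha>. The pair (0, \<alpha>) reduces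
  it to \<open>P 0\<close> and a multiplication, and f = g = 1 gives additivity off the
  diagonal.\<close>

lemma L_equations:
  fixes P :: "'k \<Rightarrow> 'k laurent \<Rightarrow> 'k laurent"
  assumes LL: "\<And>\<alpha> \<beta> f g. \<alpha> \<in> G \<Longrightarrow> \<beta> \<in> G \<Longrightarrow> \<alpha> \<noteq> \<beta> \<Longrightarrow> P (\<alpha> + \<beta>) (f * g) = P \<alpha> f * g + f * P \<beta> g"
  shows "P 0 (f * g) = P 0 f * g + f * P 0 g"
    and "\<alpha> \<in> G \<Longrightarrow> P \<alpha> f = P 0 f + f * P \<alpha> 1"
    and "\<alpha> \<in> G \<Longrightarrow> \<beta> \<in> G \<Longrightarrow> P (\<alpha> + \<beta>) 1 = P \<alpha> 1 + P \<beta> 1"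
    and "P 0 1 = 0"
proof -
  have shift: "P \<beta> (f * g) = P 0 f * g + f * P \<beta> g" if "\<beta> \<in> G" "\<beta> \<noteq> 0"
    for \<beta> f g
    using LL[of 0 \<beta> f g] that by simp
  \<comment> \<open>The pair (0, 0) is excluded, so the Leibniz rule for \<open>P 0\<close> is
    extracted from the pair (0, 2s).\<close>
  have s2: "2 * s \<noteq> 0" using s_nonzero by simp
  show one: "P 0 1 = 0" using shift[OF double_s s2, of 1 1] by simp
  have eq: "P \<alpha> f = P 0 f + f * P \<alpha> 1" if "\<alpha> \<in> G" for \<alpha> f
    using shift[OF that, of f 1] one by (cases "\<alpha> = 0") auto
  then show "\<alpha> \<in> G \<Longrightarrow> P \<alpha> f = P 0 f + f * P \<alpha> 1" .
  show "P 0 (f * g) = P 0 f * g + f * P 0 g"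
    using shift[OF double_s s2, of f g] eq[OF double_s, of "f * g"] eq[OF double_s, of g]
    by (simp add: algebra_simps)
  have add: "P (\<alpha> + \<beta>) 1 = P \<alpha> 1 + P \<beta> 1" if "\<alpha> \<in> G" "\<beta> \<in> G" "\<alpha> \<noteq> \<beta>"
    for \<alpha> \<beta>
    using LL[OF that, of 1 1] by simp
  show "P (\<alpha> + \<beta>) 1 = P \<alpha> 1 + P \<beta> 1" if "\<alpha> \<in> G" "\<beta> \<in> G"
  proof (cases "\<alpha> = \<beta> \<and> \<alpha> \<noteq> 0")
    case True
    \<comment> \<open>The excluded sum \<alpha> + \<alpha> is approached from the other side:
      \<alpha> = 2\<alpha> + (-\<alpha>) and 0 = \<alpha> + (-\<alpha>) are both admissible.\<close>
    then have "\<alpha> \<noteq> - \<alpha>" by (auto simp: eq_neg_iff_add_eq_0 mult_2[symmetric])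
    then have "P 0 1 = P \<alpha> 1 + P (- \<alpha>) 1"
      using add[of \<alpha> "- \<alpha>"] that minus_in by simp
    moreover have "P \<alpha> 1 = P (\<alpha> + \<alpha>) 1 + P (- \<alpha>) 1"
      using add[OF add_in[OF that(1) that(1)] minus_in[OF that(1)] double_neq] True by auto
    ultimately show ?thesis using one True by (simp add: eq_neg_iff_add_eq_0[symmetric])
  next
    case False
    then show ?thesis using add that one by auto
  qed
qed

text \<open>\<open>Q \<alpha>\<close> is the component from L_\<alpha> to M_\<alpha>. For \<alpha>
  \<noteq> 0 the pair (0, \<alpha>) shows that it is a multiplication.\<close>

lemma LM_component_equations:
  fixes Q :: "'k \<Rightarrow> 'k laurent \<Rightarrow> 'k laurent"
  assumes LL: "\<And>\<alpha> \<beta> f g. \<alpha> \<in> G \<Longrightarrow> \<beta> \<in> G \<Longrightarrow>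
      vscale (\<beta> - \<alpha>) (Q (\<alpha> + \<beta>) (f * g)) = vscale \<beta> (f * Q \<beta> g) - vscale \<alpha> (Q \<alpha> f * g)"
  shows "\<alpha> \<in> G \<Longrightarrow> Q \<alpha> f = Q \<alpha> 1 * f" and "(\<lambda>\<alpha>. Q \<alpha> 1) \<in> g_space G"
proof -
  have nz: "Q \<alpha> f = Q \<alpha> 1 * f" if "\<alpha> \<in> G" "\<alpha> \<noteq> 0" for \<alpha> f
    using LL[of 0 \<alpha> f 1] that by (simp add: mult.commute)
  have s2: "2 * s \<noteq> 0" "- (2 * s) \<noteq> 0" using s_nonzero by simp_all
  \<comment> \<open>At weight 0 the pair (0, 0) gives nothing; the pair (-2s, 2s) expresses 4s times
    \<open>Q 0\<close> by two multiplications.\<close>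
  have zero: "vscale (2 * s + 2 * s) (Q 0 f) = vscale (2 * s) (f * Q (2 * s) 1) + vscale (2 * s) (Q (- (2 * s)) 1 * f)"
    for f
    using LL[OF minus_in[OF double_s] double_s, of f 1] nz[OF minus_in[OF double_s] s2(2), of f] by simp
  have "vscale (2 * s + 2 * s) (Q 0 f) = vscale (2 * s + 2 * s) (Q 0 1) * f" for f
    unfolding zero by (simp add: distrib_left vscale_mult_right mult.commute)
  then have "vscale (4 * s) (Q 0 f) = vscale (4 * s) (Q 0 1 * f)" for f
    by (simp add: vscale_mult_left)
  then have "Q 0 f = Q 0 1 * f" for f
    by (rule vs.scale_left_imp_eq[rotated]) (simp add: s_nonzero)
  with nz show "\<alpha> \<in> G \<Longrightarrow> Q \<alpha> f = Q \<alpha> 1 * f" by (cases "\<alpha> = 0") blast+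
  show "(\<lambda>\<alpha>. Q \<alpha> 1) \<in> g_space G"
    using LL[of _ _ 1 1] by (simp add: g_space_def)
qed

text \<open>\<open>S \<beta>\<close> is the operator on M_\<beta>. Every L_\<alpha> kills M_0, so
  information about \<open>S 0\<close> comes from pairs (-\<beta>, \<beta>) with \<beta> \<noteq> 0.
  At f = 1 they show that \<open>S \<beta> 1 - P \<beta> 1\<close> is the same for all such \<beta>,
  namely \<open>S 0 1\<close>.\<close>

lemma M_equations:
  fixes P S :: "'k \<Rightarrow> 'k laurent \<Rightarrow> 'k laurent"
  assumes P: "\<And>\<alpha> f. \<alpha> \<in> G \<Longrightarrow> P \<alpha> f = P 0 f + f * P \<alpha> 1"
      "\<And>\<alpha> \<beta>. \<alpha> \<in> G \<Longrightarrow> \<beta> \<in> G \<Longrightarrow> P (\<alpha> + \<beta>) 1 = P \<alpha> 1 + P \<beta> 1" "P 0 1 = 0"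
    and LM: "\<And>\<alpha> \<beta> f g. \<alpha> \<in> G \<Longrightarrow> \<beta> \<in> G \<Longrightarrow> \<beta> \<noteq> 0 \<Longrightarrow> S (\<alpha> + \<beta>) (f * g) = P \<alpha> f * g + f * S \<beta> g"
  shows "\<beta> \<in> G \<Longrightarrow> S \<beta> f = P 0 f + (P \<beta> 1 + S 0 1) * f"
proof -
  have nz: "S \<beta> f = P 0 f + f * S \<beta> 1" if "\<beta> \<in> G" "\<beta> \<noteq> 0" for \<beta> f
    using LM[of 0 \<beta> f 1] that by simp
  have z: "S 0 f = P (- \<beta>) f + f * S \<beta> 1" if "\<beta> \<in> G" "\<beta> \<noteq> 0" for \<beta> f
    using LM[of "- \<beta>" \<beta> f 1] that minus_in by simp
  have S1: "S \<beta> 1 = P \<beta> 1 + S 0 1" if "\<beta> \<in> G" "\<beta> \<noteq> 0" for \<beta>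
    using z[OF that, of 1] P(2)[of \<beta> "- \<beta>"] P(3) minus_in that by (simp add: add_eq_0_iff)
  have s2: "2 * s \<noteq> 0" using s_nonzero by simp
  have zero: "S 0 f = P 0 f + S 0 1 * f" for f
    using z[OF double_s s2, of f] z[OF double_s s2, of 1] P(1)[OF minus_in[OF double_s], of f]
    by (simp add: algebra_simps)
  show "S \<beta> f = P 0 f + (P \<beta> 1 + S 0 1) * f" if "\<beta> \<in> G"
  proof (cases "\<beta> = 0")
    case True
    then show ?thesis using zero[of f] P(3) by (simp only: add_0_left)
  next
    case False
    show ?thesis unfolding nz[OF that False, of f] S1[OF that False] by (simp add: mult.commute)
  qed
qed

text \<open>\<open>U \<nu>\<close> is the operator on Y_\<nu>. By [Y, Y] the values at 1 satisfy
  U_\<mu> + U_\<nu> = P_{\<mu>+\<nu>} + b, so subtracting b / 2 from each U makes it fit together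
  with P into one additive map on all weights.\<close>

lemma Y_equations:
  fixes P S U :: "'k \<Rightarrow> 'k laurent \<Rightarrow> 'k laurent" and b :: "'k laurent"
  assumes P: "\<And>\<alpha> \<beta>. \<alpha> \<in> G \<Longrightarrow> \<beta> \<in> G \<Longrightarrow> P (\<alpha> + \<beta>) 1 = P \<alpha> 1 + P \<beta> 1" "P 0 1 = 0"
    and S: "\<And>\<alpha>. \<alpha> \<in> G \<Longrightarrow> S \<alpha> 1 = P \<alpha> 1 + b"
    and LY: "\<And>\<alpha> \<nu> f g. \<alpha> \<in> G \<Longrightarrow> \<nu> \<in> shifted G s \<Longrightarrow> \<nu> \<noteq> \<alpha> / 2 \<Longrightarrow>
      U (\<alpha> + \<nu>) (f * g) = P \<alpha> f * g + f * U \<nu> g"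
    and YY: "\<And>\<mu> \<nu> f g. \<mu> \<in> shifted G s \<Longrightarrow> \<nu> \<in> shifted G s \<Longrightarrow> \<mu> \<noteq> \<nu> \<Longrightarrow>
      S (\<mu> + \<nu>) (f * g) = U \<mu> f * g + f * U \<nu> g"
  shows "\<nu> \<in> shifted G s \<Longrightarrow> U \<nu> f = P 0 f + f * U \<nu> 1"
    and "(\<lambda>\<mu>. if \<mu> \<in> G then P \<mu> 1 else U \<mu> 1 - vscale (1 / 2) b) \<in> hom_weights G s"
      (is "?\<phi> \<in> _")
proof -
  show "\<nu> \<in> shifted G s \<Longrightarrow> U \<nu> f = P 0 f + f * U \<nu> 1"
    using LY[of 0 \<nu> f 1] shifted_nonzero[of \<nu>] by simp
  have generic: "U (\<alpha> + \<nu>) 1 = P \<alpha> 1 + U \<nu> 1" if "\<alpha> \<in> G" "\<nu> \<in> shifted G s" "\<nu> \<noteq> \<alpha> / 2"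
    for \<alpha> \<nu>
    using LY[OF that, of 1 1] by simp
  text \<open>The excluded case \<open>\<alpha> = 2 * \<nu>\<close> is reached in two admissible steps, by \<open>-\<alpha>\<close> and \<open>2 * \<alpha>\<close>.\<close>
  have LU: "U (\<alpha> + \<nu>) 1 = P \<alpha> 1 + U \<nu> 1" if "\<alpha> \<in> G" "\<nu> \<in> shifted G s"
    for \<alpha> \<nu>
  proof (cases "\<nu> = \<alpha> / 2")
    case True
    have \<alpha>: "\<alpha> = \<nu> + \<nu>" unfolding True by (simp add: mult_2[symmetric])
    have "\<nu> \<noteq> 0" using shifted_nonzero[OF that(2)] .
    \<comment> \<open>The intermediate weight is -\<nu>; the two inequalities say that neither step
      meets its own exceptional weight.\<close>
    have "- \<nu> \<noteq> \<nu>" "- \<nu> \<noteq> \<nu> + \<nu>"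
      using \<open>\<nu> \<noteq> 0\<close> double_neq[OF \<open>\<nu> \<noteq> 0\<close>]
        by (auto simp: eq_neg_iff_add_eq_0 neg_eq_iff_add_eq_0 mult_2[symmetric])
    have "U (- \<alpha> + \<nu>) 1 = P (- \<alpha>) 1 + U \<nu> 1"
      using generic[of "- \<alpha>" \<nu>] that minus_in \<alpha> \<open>- \<nu> \<noteq> \<nu>\<close>
        by (auto simp: field_simps)
    moreover have "U ((\<alpha> + \<alpha>) + (- \<alpha> + \<nu>)) 1 = P (\<alpha> + \<alpha>) 1 + U (- \<alpha> + \<nu>) 1"
    proof (rule generic)
      show "- \<alpha> + \<nu> \<noteq> (\<alpha> + \<alpha>) / 2" using \<open>- \<nu> \<noteq> \<nu> + \<nu>\<close>
        by (simp add: \<alpha>)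
    qed (intro shifted_add minus_in add_in that)+
    moreover have "(\<alpha> + \<alpha>) + (- \<alpha> + \<nu>) = \<alpha> + \<nu>" by simp
    moreover have "P (\<alpha> + \<alpha>) 1 = P \<alpha> 1 + P \<alpha> 1" "P (- \<alpha>) 1 = - P \<alpha> 1"
      using P(1)[of \<alpha> \<alpha>] P(1)[of "- \<alpha>" \<alpha>] P(2) that minus_in
        by (auto simp: eq_neg_iff_add_eq_0)
    ultimately show ?thesis by simp
  qed (use generic that in blast)
  \<comment> \<open>On the diagonal, the pair (\<nu>, -\<nu>) gives b and L_{2\<nu>} leads from
    -\<nu> back to \<nu>; adding the two relations eliminates U at -\<nu>.\<close>
  have YY': "P (\<mu> + \<nu>) 1 + b = U \<mu> 1 + U \<nu> 1" if "\<mu> \<in> shifted G s" "\<nu> \<in> shifted G s"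
    for \<mu> \<nu>
  proof (cases "\<mu> = \<nu>")
    case True
    have m: "- \<nu> \<in> shifted G s" "\<nu> + \<nu> \<in> G"
      using that shifted_minus shifted_shifted_add by blast+
    have "\<nu> \<noteq> - \<nu>"
      using shifted_nonzero[of \<nu>] that by (auto simp: eq_neg_iff_add_eq_0 mult_2[symmetric])
    have "b = U \<nu> 1 + U (- \<nu>) 1"
      using YY[of \<nu> "- \<nu>" 1 1] S[of 0] m that P(2) \<open>\<nu> \<noteq> - \<nu>\<close> by simp
    moreover have "U \<nu> 1 = P (\<nu> + \<nu>) 1 + U (- \<nu>) 1"
      using LU[OF m(2,1)] by simp
    ultimately show ?thesis using True by (simp add: algebra_simps)
  next
    case False
    then show ?thesis
      using YY[of \<mu> \<nu> 1 1] S[of "\<mu> + \<nu>"] that shifted_shifted_add by simp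
  qed
  have half: "vscale (1 / 2) b + vscale (1 / 2) b = b"
    by (simp add: vs.scale_left_distrib[symmetric])
  have "?\<phi> (\<mu> + \<nu>) = ?\<phi> \<mu> + ?\<phi> \<nu>" if w: "\<mu> \<in> weights G s" "\<nu> \<in> weights G s"
    for \<mu> \<nu>
  proof -
    consider "\<mu> \<in> G" "\<nu> \<in> G" | "\<mu> \<in> G" "\<nu> \<in> shifted G s" | "\<mu> \<in> shifted G s" "\<nu> \<in> G"
      | "\<mu> \<in> shifted G s" "\<nu> \<in> shifted G s"
      using w unfolding weights_def by blast
    then show ?thesis
    proof cases
      case 1
      then show ?thesis using add_in P(1) by simp
    next
      case 2
      then show ?thesis using shifted_disjoint[of \<nu>] shifted_disjoint[OF shifted_add[of \<mu> \<nu>]] LU[of \<mu> \<nu>] by simp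
    next
      case 3
      then show ?thesis
        using shifted_disjoint[of \<mu>] shifted_disjoint[OF shifted_add[of \<nu> \<mu>]] LU[of \<nu> \<mu>]
        by (simp add: add.commute)
    next
      case 4
      have "P (\<mu> + \<nu>) 1 = (U \<mu> 1 + U \<nu> 1) - b"
        using YY'[OF 4] by (simp add: algebra_simps)
      also have "\<dots> = (U \<mu> 1 - vscale (1 / 2) b) + (U \<nu> 1 - vscale (1 / 2) b)"
        by (subst half[symmetric]) (simp add: algebra_simps)
      finally show ?thesis
        using 4 shifted_disjoint[of \<mu>] shifted_disjoint[of \<nu>] shifted_shifted_add by simp
    qed
  qed
  then show "?\<phi> \<in> hom_weights G s" unfolding hom_weights_def by blast
qed

section \<open>From the functional equations to the outer derivations\<close>

lemma weight_preserving_Der: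
  assumes D: "D \<in> sv_Der G s"
    and pres: "\<And>X Y \<mu> \<nu> f. \<mu> \<in> wt X \<Longrightarrow> \<nu> \<noteq> \<mu> \<Longrightarrow> cmp Y \<nu> (D (tens X \<mu> f)) = 0"
  shows "D \<in> DD_Hom G s + DD_g G s + DD_b G s + DD_rho G s"
proof -
  have endo: "D \<in> endos vscale W" using D by (simp add: sv_Der_iff)
  have D0: "D 0 = 0" using endosD(3)[OF endo sv_space_0 sv_space_0] by simp
  have wt: "\<alpha> \<in> wt SVL \<longleftrightarrow> \<alpha> \<in> G" "\<alpha> \<in> wt SVM \<longleftrightarrow> \<alpha> \<in> G" "\<alpha> \<in> wt SVY \<longleftrightarrow> \<alpha> \<in> shifted G s"
    for \<alpha>
    by (simp_all add: kind_weights_def)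
  \<comment> \<open>As \<open>G\<close> and its shift by s are disjoint, L and M can mix only with
    each other at a common weight and Y only with itself; these five components are all.\<close>
  define P where "P \<alpha> f = cmp SVL \<alpha> (D (tens SVL \<alpha> f))" for \<alpha> f
  define Q where "Q \<alpha> f = cmp SVM \<alpha> (D (tens SVL \<alpha> f))" for \<alpha> f
  define R where "R \<alpha> f = cmp SVL \<alpha> (D (tens SVM \<alpha> f))" for \<alpha> f
  define S where "S \<alpha> f = cmp SVM \<alpha> (D (tens SVM \<alpha> f))" for \<alpha> f
  define U where "U \<nu> f = cmp SVY \<nu> (D (tens SVY \<nu> f))" for \<nu> f
  have outside: "cmp Y \<nu> (D (tens X \<mu> f)) = 0" if "\<mu> \<in> wt X" "\<nu> \<notin> wt Y"
    for X Y \<mu> \<nu> f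
    using endosD(1)[OF endo tens_in_space[OF that(1)]] that(2) by (simp add: sv_space_iff_cmp)
  have DL: "D (tens SVL \<alpha> f) = tens SVL \<alpha> (P \<alpha> f) + tens SVM \<alpha> (Q \<alpha> f)" if "\<alpha> \<in> G"
    for \<alpha> f
  proof (rule cmp_eqI)
    show "cmp Y \<nu> (D (tens SVL \<alpha> f)) = cmp Y \<nu> (tens SVL \<alpha> (P \<alpha> f) + tens SVM \<alpha> (Q \<alpha> f))"
      for Y \<nu>
      using pres[of \<alpha> SVL \<nu> Y f] outside[of \<alpha> SVL \<nu> SVY f] that shifted_disjoint[of \<alpha>]
      by (cases "\<nu> = \<alpha>"; cases Y) (auto simp: cmp_add cmp_tens P_def Q_def wt)
  qed
  have DM': "D (tens SVM \<alpha> f) = tens SVL \<alpha> (R \<alpha> f) + tens SVM \<alpha> (S \<alpha> f)" if "\<alpha> \<in> G"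
    for \<alpha> f
  proof (rule cmp_eqI)
    show "cmp Y \<nu> (D (tens SVM \<alpha> f)) = cmp Y \<nu> (tens SVL \<alpha> (R \<alpha> f) + tens SVM \<alpha> (S \<alpha> f))"
      for Y \<nu>
      using pres[of \<alpha> SVM \<nu> Y f] outside[of \<alpha> SVM \<nu> SVY f] that shifted_disjoint[of \<alpha>]
      by (cases "\<nu> = \<alpha>"; cases Y) (auto simp: cmp_add cmp_tens R_def S_def wt)
  qed
  have DY: "D (tens SVY \<alpha> f) = tens SVY \<alpha> (U \<alpha> f)" if "\<alpha> \<in> shifted G s" for \<alpha> f
  proof (rule cmp_eqI)
    show "cmp Y \<nu> (D (tens SVY \<alpha> f)) = cmp Y \<nu> (tens SVY \<alpha> (U \<alpha> f))" for Y \<nu>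
      using pres[of \<alpha> SVY \<nu> Y f] outside[of \<alpha> SVY \<nu> SVL f] outside[of \<alpha> SVY \<nu> SVM f] that
        shifted_disjoint[of \<alpha>]
      by (cases "\<nu> = \<alpha>"; cases Y) (auto simp: cmp_tens U_def wt)
  qed
  have leib: "vscale (br_coeff X Y \<mu> \<nu>) (D (tens (br_kind X Y) (\<mu> + \<nu>) (f * g))) =
      sv_bracket (D (tens X \<mu> f)) (tens Y \<nu> g) + sv_bracket (tens X \<mu> f) (D (tens Y \<nu> g))"
    if "\<mu> \<in> wt X" "\<nu> \<in> wt Y" for X Y \<mu> \<nu> f g
  proof -
    have "D (sv_bracket (tens X \<mu> f) (tens Y \<nu> g)) =
        vscale (br_coeff X Y \<mu> \<nu>) (D (tens (br_kind X Y) (\<mu> + \<nu>) (f * g)))"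
      using endosD(2)[OF endo tens_in_space[OF weights_br_kind[OF that]]] D0
      by (cases "br_coeff X Y \<mu> \<nu> = 0") (simp_all add: sv_bracket_tens)
    then show ?thesis using D that tens_in_space by (metis sv_Der_iff)
  qed
  \<comment> \<open>Applying the derivation to [M_\<alpha>, Y_\<nu>] = 0 leaves only the bracket of
    the L-part with Y_\<nu>, whose constant is nonzero for the chosen \<nu>.\<close>
  have R0: "R \<alpha> f = 0" if "\<alpha> \<in> G" for \<alpha> f
  proof -
    obtain \<nu> where \<nu>: "\<nu> \<in> shifted G s" "\<nu> \<noteq> \<alpha> / 2"
      using exists_shifted_neq by blast
    have "vscale (\<nu> - \<alpha> / 2) (tens SVY (\<alpha> + \<nu>) (R \<alpha> f * 1)) = 0"
      using leib[of \<alpha> SVM \<nu> SVY f 1] that \<nu>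
      by (simp add: wt DM' DY sv_bracket_add_left sv_bracket_tens)
    then have "tens SVY (\<alpha> + \<nu>) (R \<alpha> f) = tens SVY (\<alpha> + \<nu>) 0" using \<nu>(2) by simp
    then show ?thesis by (simp only: tens_eq_iff)
  qed
  have DM: "D (tens SVM \<alpha> f) = tens SVM \<alpha> (S \<alpha> f)" if "\<alpha> \<in> G" for \<alpha> f
    using DM' that R0 by simp
  have LLL: "P (\<alpha> + \<beta>) (f * g) = P \<alpha> f * g + f * P \<beta> g" if "\<alpha> \<in> G" "\<beta> \<in> G" "\<alpha> \<noteq> \<beta>"
    for \<alpha> \<beta> f g
  proof -
    have "vscale (\<beta> - \<alpha>) (P (\<alpha> + \<beta>) (f * g)) = vscale (\<beta> - \<alpha>) (P \<alpha> f * g + f * P \<beta> g)"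
      using arg_cong[OF leib[of \<alpha> SVL \<beta> SVL f g], of "cmp SVL (\<alpha> + \<beta>)"] that add_in
      by (simp add: wt DL sv_bracket_add_left sv_bracket_add_right sv_bracket_tens cmp_add cmp_vscale
          cmp_tens cmp_diff cmp_uminus vs.scale_right_distrib del: vs.scale_cancel_left)
    then show ?thesis using that(3) by (simp only: vs.scale_cancel_left) simp
  qed
  \<comment> \<open>The three constants differ here, so nothing is cancelled, and the equation holds
    for \<alpha> = \<beta> as well.\<close>
  have LLM: "vscale (\<beta> - \<alpha>) (Q (\<alpha> + \<beta>) (f * g)) = vscale \<beta> (f * Q \<beta> g) - vscale \<alpha> (Q \<alpha> f * g)"
    if "\<alpha> \<in> G" "\<beta> \<in> G" for \<alpha> \<beta> f g
    using arg_cong[OF leib[of \<alpha> SVL \<beta> SVL f g], of "cmp SVM (\<alpha> + \<beta>)"] that add_in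
    by (simp add: wt DL sv_bracket_add_left sv_bracket_add_right sv_bracket_tens cmp_add cmp_vscale
        cmp_tens cmp_diff cmp_uminus)
  have LM: "S (\<alpha> + \<beta>) (f * g) = P \<alpha> f * g + f * S \<beta> g" if "\<alpha> \<in> G" "\<beta> \<in> G" "\<beta> \<noteq> 0"
    for \<alpha> \<beta> f g
  proof -
    have "vscale \<beta> (S (\<alpha> + \<beta>) (f * g)) = vscale \<beta> (P \<alpha> f * g + f * S \<beta> g)"
      using arg_cong[OF leib[of \<alpha> SVL \<beta> SVM f g], of "cmp SVM (\<alpha> + \<beta>)"] that add_in
      by (simp add: wt DL DM sv_bracket_add_left sv_bracket_tens cmp_add cmp_vscale
          cmp_tens vs.scale_right_distrib del: vs.scale_cancel_left)
    then show ?thesis using that(3) by (simp only: vs.scale_cancel_left) simp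
  qed
  have LY: "U (\<alpha> + \<nu>) (f * g) = P \<alpha> f * g + f * U \<nu> g"
    if "\<alpha> \<in> G" "\<nu> \<in> shifted G s" "\<nu> \<noteq> \<alpha> / 2" for \<alpha> \<nu> f g
  proof -
    have "vscale (\<nu> - \<alpha> / 2) (U (\<alpha> + \<nu>) (f * g)) = vscale (\<nu> - \<alpha> / 2) (P \<alpha> f * g + f * U \<nu> g)"
      using arg_cong[OF leib[of \<alpha> SVL \<nu> SVY f g], of "cmp SVY (\<alpha> + \<nu>)"] that shifted_add
      by (simp add: wt DL DY sv_bracket_add_left sv_bracket_tens cmp_add cmp_vscale
          cmp_tens vs.scale_right_distrib del: vs.scale_cancel_left)
    then show ?thesis using that(3) by (simp only: vs.scale_cancel_left) simp
  qed
  have YY: "S (\<mu> + \<nu>) (f * g) = U \<mu> f * g + f * U \<nu> g"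
    if "\<mu> \<in> shifted G s" "\<nu> \<in> shifted G s" "\<mu> \<noteq> \<nu>" for \<mu> \<nu> f g
  proof -
    have "vscale (\<nu> - \<mu>) (S (\<mu> + \<nu>) (f * g)) = vscale (\<nu> - \<mu>) (U \<mu> f * g + f * U \<nu> g)"
      using arg_cong[OF leib[of \<mu> SVY \<nu> SVY f g], of "cmp SVM (\<mu> + \<nu>)"] that shifted_shifted_add
      by (simp add: wt DM DY sv_bracket_tens cmp_add cmp_vscale
          cmp_tens vs.scale_right_distrib del: vs.scale_cancel_left)
    then show ?thesis using that(3) by (simp only: vs.scale_cancel_left) simp
  qed
  have P1: "P 0 (f * g) = P 0 f * g + f * P 0 g" for f g
    by (rule L_equations(1)) (rule LLL)
  have P2: "P \<alpha> f = P 0 f + f * P \<alpha> 1" if "\<alpha> \<in> G" for \<alpha> f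
    by (rule L_equations(2)[OF _ that]) (rule LLL)
  have P3: "P (\<alpha> + \<beta>) 1 = P \<alpha> 1 + P \<beta> 1" if "\<alpha> \<in> G" "\<beta> \<in> G"
    for \<alpha> \<beta>
    by (rule L_equations(3)[OF _ that]) (rule LLL)
  have P4: "P 0 1 = 0"
    by (rule L_equations(4)) (rule LLL)
  have Q1: "Q \<alpha> f = Q \<alpha> 1 * f" if "\<alpha> \<in> G" for \<alpha> f
    by (rule LM_component_equations(1)[OF _ that]) (rule LLM)
  have Q2: "(\<lambda>\<alpha>. Q \<alpha> 1) \<in> g_space G"
    by (rule LM_component_equations(2)) (rule LLM)
  \<comment> \<open>The image of M_{0,0} sees only the b-part, since \<phi> vanishes at 0, \<rho> at
    1, and \<open>D_g\<close> on M.\<close>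
  define b where "b = S 0 1"
  have S: "S \<alpha> f = P 0 f + (P \<alpha> 1 + b) * f" if "\<alpha> \<in> G" for \<alpha> f
    unfolding b_def by (rule M_equations[OF _ _ _ _ that]) (rule P2 P3 P4 LM; assumption)+
  have S1: "S \<alpha> 1 = P \<alpha> 1 + b" if "\<alpha> \<in> G" for \<alpha>
    using S[OF that, of 1] P4 by simp
  have U1: "U \<nu> f = P 0 f + f * U \<nu> 1" if "\<nu> \<in> shifted G s" for \<nu> f
    by (rule Y_equations(1)[OF _ _ _ _ _ that]) (rule P3 P4 S1 LY YY; assumption)+
  define \<phi> where "\<phi> \<mu> = (if \<mu> \<in> G then P \<mu> 1 else U \<mu> 1 - vscale (1 / 2) b)" for \<mu>
  have \<phi>: "\<phi> \<in> hom_weights G s" unfolding \<phi>_def[abs_def]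
    by (rule Y_equations(2)) (rule P3 P4 S1 LY YY; assumption)+
  have \<rho>: "P 0 \<in> laurent_ders"
  proof -
    have "P 0 (f + g) = P 0 f + P 0 g" "P 0 (vscale c f) = vscale c (P 0 f)" for c f g
      by (simp_all add: P_def tens_add tens_vscale endosD(2,3)[OF endo] tens_in_space wt cmp_add cmp_vscale)
    then show ?thesis unfolding laurent_ders_iff using P1 by blast
  qed
  have "D = D_phi G s \<phi> + D_g G s (\<lambda>\<alpha>. Q \<alpha> 1) + D_b G s b + D_rho G s (P 0)" (is "D = ?E")
  proof (rule endos_eqI[OF endo])
    show "?E \<in> endos vscale W"
      using D_endos[of G s] endos_subspace[of G s] by (intro fs.subspace_add)
    fix X \<mu> f assume \<mu>: "\<mu> \<in> wt X"
    have E: "?E (tens X \<mu> f) = tens X \<mu> (\<phi> \<mu> * f) + (if X = SVL then tens SVM \<mu> (Q \<mu> 1 * f) else 0) +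
        tens X \<mu> (vscale (b_weight X) (b * f)) + tens X \<mu> (P 0 f)"
      using \<mu> by (simp add: D_phi_tens D_g_tens D_b_tens D_rho_tens[OF \<rho>])
    show "D (tens X \<mu> f) = ?E (tens X \<mu> f)"
    proof (cases X)
      case SVL
      then have "\<mu> \<in> G" using \<mu> wt by simp
      have "P \<mu> f = P 0 f + f * \<phi> \<mu>" using P2[OF \<open>\<mu> \<in> G\<close>, of f] \<open>\<mu> \<in> G\<close>
        by (simp only: \<phi>_def if_True)
      moreover have "Q \<mu> f = Q \<mu> 1 * f" using Q1[OF \<open>\<mu> \<in> G\<close>] .
      ultimately show ?thesis
        unfolding E using SVL DL[OF \<open>\<mu> \<in> G\<close>, of f] by (simp add: tens_add mult.commute add_ac)
    next
      case SVM
      then have "\<mu> \<in> G" using \<mu> wt by simp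
      have "S \<mu> f = P 0 f + (\<phi> \<mu> + b) * f" using S[OF \<open>\<mu> \<in> G\<close>, of f] \<open>\<mu> \<in> G\<close>
        by (simp only: \<phi>_def if_True)
      then show ?thesis
        unfolding E using SVM DM[OF \<open>\<mu> \<in> G\<close>, of f] by (simp add: tens_add distrib_right add_ac)
    next
      case SVY
      then have sh: "\<mu> \<in> shifted G s" using \<mu> wt by simp
      then have "U \<mu> 1 = \<phi> \<mu> + vscale (1 / 2) b" using shifted_disjoint by (simp add: \<phi>_def)
      then have "U \<mu> f = P 0 f + f * (\<phi> \<mu> + vscale (1 / 2) b)" using U1[OF sh, of f] by (simp only:)
      then show ?thesis
        unfolding E using SVY DY[OF sh, of f]
        by (simp add: tens_add distrib_left vscale_mult_right mult.commute add_ac)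
    qed
  qed
  moreover have "?E \<in> DD_Hom G s + DD_g G s + DD_b G s + DD_rho G s"
    unfolding DD_Hom_eq DD_g_eq DD_rho_eq DD_b_def using \<phi> Q2 \<rho> by (intro set_plus_intro) blast+
  ultimately show ?thesis by simp
qed

text \<open>
  Subtracting an inner derivation makes the image of $L_{0,0}$ homogeneous of weight 0. As the
  weight spaces are the eigenspaces of \<open>ad\<close> $L_{0,0}$, the difference then preserves weights.
\<close>

lemma sv_Der_subset: "sv_Der G s \<subseteq> sv_ad G s + (DD_Hom G s + DD_g G s + DD_b G s + DD_rho G s)"
proof
  fix D assume D: "D \<in> sv_Der G s"
  have L0: "0 \<in> wt SVL" by (simp add: kind_weights_def)
  let ?L0 = "tens SVL 0 1 :: 'k sv"
  define u where "u = D ?L0"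
  have uW: "u \<in> W" unfolding u_def
    using D by (intro endosD(1)[OF _ tens_in_space[OF L0]]) (simp add: sv_Der_iff)
  \<comment> \<open>Solves -\<mu> z_\<mu> = u_\<mu>, the condition for [z, L_{0,0}] to agree with
    \<open>u\<close> away from weight 0. At \<mu> = 0 division by zero gives the coefficient 0, so
    \<open>z\<close> has no part there.\<close>
  define z where "z = lin_ext (\<lambda>(X, \<mu>, i). Poly_Mapping.single (X, \<mu>, i) (- 1 / \<mu>)) u"
  have cz: "cmp X \<mu> z = vscale (- 1 / \<mu>) (cmp X \<mu> u)" for X \<mu>
    unfolding z_def
  proof (induction u rule: poly_mapping_additive_induct)
    case (1 p a)
    obtain Y \<nu> i where p: "p = (Y, \<nu>, i)" by (cases p)
    show ?case
      using cmp_tens[of X \<mu> Y \<nu> "Poly_Mapping.single i (a / \<nu>)"]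
        cmp_tens[of X \<mu> Y \<nu> "Poly_Mapping.single i a"]
      by (auto simp: p single_uminus cmp_uminus)
  qed (simp add: lin_ext_add cmp_add vs.scale_right_distrib)
  have z: "z \<in> W" using uW by (simp add: sv_space_iff_cmp cz)
  define E where "E = D - ad z"
  have E: "E \<in> sv_Der G s"
    unfolding E_def by (rule fs.subspace_diff[OF sv_Der_subspace D ad_in_Der[OF z]])
  have EL0: "cmp X \<mu> (E ?L0) = 0" if "\<mu> \<noteq> 0" for X \<mu>
  proof -
    have "E ?L0 = u + sv_bracket ?L0 z"
      using sv_bracket_antisym[of z ?L0] by (simp add: E_def u_def on_space_def tens_in_space L0)
    then show ?thesis using that by (simp add: cmp_add sv_bracket_L0 cz)
  qed
  have "E \<in> DD_Hom G s + DD_g G s + DD_b G s + DD_rho G s"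
  proof (rule weight_preserving_Der[OF E])
    fix X Y \<mu> \<nu> f assume \<mu>: "\<mu> \<in> wt X" "\<nu> \<noteq> \<mu>"
    \<comment> \<open>Both sides of the Leibniz rule are compared at weight \<nu>: the term with
      E(L_{0,0}) stays in weight \<mu>, which leaves the eigenvalue \<mu> against \<nu>.\<close>
    have "E (sv_bracket ?L0 (tens X \<mu> f)) = vscale \<mu> (E (tens X \<mu> f))"
    proof -
      have "br_coeff SVL X 0 \<mu> = \<mu>" by (cases X) auto
      then show ?thesis
        using endosD(2)[of E G s "tens X \<mu> f" \<mu>] E \<mu>(1)
        by (simp add: sv_bracket_tens sv_Der_iff tens_in_space)
    qed
    moreover have "E (sv_bracket ?L0 (tens X \<mu> f)) = sv_bracket (E ?L0) (tens X \<mu> f) + sv_bracket ?L0 (E (tens X \<mu> f))"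
      using E \<mu>(1) L0 by (simp add: sv_Der_iff tens_in_space)
    moreover have "cmp Y \<nu> (sv_bracket (E ?L0) (tens X \<mu> f)) = 0"
    proof -
      let ?c = "\<lambda>X. tens X 0 (cmp X 0 (E ?L0))"
      have E0: "E ?L0 = ?c SVL + ?c SVM + ?c SVY"
      proof (rule cmp_eqI)
        show "cmp X \<mu> (E ?L0) = cmp X \<mu> (?c SVL + ?c SVM + ?c SVY)" for X \<mu>
          using EL0[of \<mu> X] by (cases X; cases "\<mu> = 0") (simp_all add: cmp_add cmp_tens)
      qed
      show ?thesis
        by (subst E0) (use \<mu>(2) in \<open>simp add: sv_bracket_add_left sv_bracket_tens cmp_add cmp_vscale cmp_tens\<close>)
    qed
    ultimately have "vscale \<mu> (cmp Y \<nu> (E (tens X \<mu> f))) = vscale \<nu> (cmp Y \<nu> (E (tens X \<mu> f)))"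
      by (metis add_0 cmp_add cmp_vscale sv_bracket_L0)
    then show "cmp Y \<nu> (E (tens X \<mu> f)) = 0" using \<mu>(2) by simp
  qed
  moreover have "D = ad z + E" by (simp add: E_def)
  ultimately show "D \<in> sv_ad G s + (DD_Hom G s + DD_g G s + DD_b G s + DD_rho G s)"
    using z unfolding sv_ad_eq by (blast intro: set_plus_intro)
qed

lemma sv_Der_decomposition:
  "sv_Der G s = sv_ad G s + (DD_Hom G s + DD_g G s + DD_b G s + DD_rho G s)"
proof (rule antisym[OF sv_Der_subset])
  have "sv_ad G s \<subseteq> sv_Der G s" by (auto simp: sv_ad_eq ad_in_Der)
  moreover have "D_phi G s \<phi> + D_g G s g + D_b G s b + D_rho G s \<rho> \<in> sv_Der G s"
    if "\<phi> \<in> hom_weights G s" "g \<in> g_space G" "\<rho> \<in> laurent_ders" for \<phi> g b \<rho>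
    using that by (intro fs.subspace_add sv_Der_subspace D_phi_in_Der D_g_in_Der D_b_in_Der D_rho_in_Der)
  then have "DD_Hom G s + DD_g G s + DD_b G s + DD_rho G s \<subseteq> sv_Der G s"
    by (auto elim!: outer_elim)
  ultimately show "sv_ad G s + (DD_Hom G s + DD_g G s + DD_b G s + DD_rho G s) \<subseteq> sv_Der G s"
    using fs.subspace_add[OF sv_Der_subspace] unfolding set_plus_def[of "sv_ad G s"] by blast
qed

end

theorem theorem2p6:
  fixes \<Gamma> :: "'k::field_char_0 set" and s :: 'k
  assumes "is_add_subgroup \<Gamma>" and "\<Gamma> \<noteq> UNIV"
    and "s \<notin> \<Gamma>" and "2 * s \<in> \<Gamma>"
  shows
    "direct_sum4 sv_fscale (DD_Hom \<Gamma> s) (DD_g \<Gamma> s) (DD_b \<Gamma> s) (DD_rho \<Gamma> s) \<and>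
     sv_Der \<Gamma> s = sv_ad \<Gamma> s + (DD_Hom \<Gamma> s + DD_g \<Gamma> s + DD_b \<Gamma> s + DD_rho \<Gamma> s) \<and>
     lin_isomorphic
       (sv_H1 \<Gamma> s) (quot_scale sv_fscale (coboundaries1 sv_bracket (sv_space \<Gamma> s)))
       (quot_space (sv_Der \<Gamma> s) (sv_ad \<Gamma> s)) (quot_scale sv_fscale (sv_ad \<Gamma> s)) \<and>
     lin_isomorphic
       (sv_H1 \<Gamma> s) (quot_scale sv_fscale (coboundaries1 sv_bracket (sv_space \<Gamma> s)))
       (outer_sum \<Gamma> s) (outer_scale \<Gamma> s)"
proof -
  interpret sv_weights \<Gamma> s
    using assms by unfold_locales
  have H1: "sv_H1 \<Gamma> s = quot_space (sv_Der \<Gamma> s) (sv_ad \<Gamma> s)"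
    by (simp add: sv_H1_def cohomology1_def cocycles1_eq coboundaries1_eq)
  have "DD_Hom' \<Gamma> s \<subseteq> DD_Hom \<Gamma> s" by (auto simp: DD_Hom'_def DD_Hom_def)
  then have "lin_isomorphic (quot_space (sv_Der \<Gamma> s) (sv_ad \<Gamma> s)) (quot_scale sv_fscale (sv_ad \<Gamma> s))
      (outer_sum \<Gamma> s) (outer_scale \<Gamma> s)"
    unfolding outer_sum_def outer_scale_def sv_Der_decomposition
    by (intro quot_sum_isomorphic fs.vector_space_axioms outer_direct sv_ad_subspace DD_subspaces
        DD_Hom'_subset_ad ad_inter_outer)
  \<comment> \<open>Cocycles are derivations and coboundaries are inner ones, so the cohomology and
    the quotient are the same set of cosets and the identity is the isomorphism.\<close>
  moreover have "lin_isomorphic A scl A scl"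
    for A :: "('k sv \<Rightarrow> 'k sv) set set" and scl :: "'k \<Rightarrow> _"
    unfolding lin_isomorphic_def by (intro exI[of _ id]) auto
  ultimately show ?thesis
    unfolding H1 coboundaries1_eq using outer_direct sv_Der_decomposition by blast
qed

end
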